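(* Suppose $\Omega\subset\mathbb{C}^d$ is a bounded convex domain and $\partial\Omega$ is $C^1$. If $\epsilon>0$ and $z_0\in\Omega$, then there exists $B=B(\epsilon,z_0)>0$ such that $$K_\Omega(q,z_0)\le B+\frac{1+\epsilon}{2}\log\frac{1}{\delta_\Omega(q)}$$ for all $q\in\Omega$. In particular, $\alpha_\star(\Omega)=1$.
   Context: $\delta_\Omega(q)=\inf\{\|q-w\|:w\in\partial\Omega\}$ (Euclidean distance). Kobayashi distance: $K_\Omega(x,y)$ is the infimum of $\int_a^b k_\Omega(\sigma(t);\sigma'(t))\,dt$ over absolutely continuous curves $\sigma:[a,b]\to\Omega$ from $x$ to $y$, where $k_\Omega(x;v)=\inf\{|\zeta|: f:\mathbb{D}\to\Omega \text{ holomorphic}, f(0)=x, f'(0)\zeta=v\}$ and $\mathbb{D}$ is the unit disk in $\mathbb{C}$. A bounded convex domain $\Omega$ is $\alpha$-regular if for any $z_0\in\Omega$ there is $B=B(\alpha,z_0)>0$ with $K_\Omega(q,z_0)\le B+\frac{\alpha}{2}\log\frac{1}{\delta_\Omega(q)}$ for all $q\in\Omega$, and $\alpha_\star(\Omega):=\inf\{\alpha>0:\Omega\text{ is }\alpha\text{-regular}\}$. *)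

theory Defs
  imports "HOL-Analysis.Analysis"
begin

text \<open>
  The space \<open>\<complex>\<^sup>d\<close> is the type \<^typ>\<open>complex^'d\<close>, whose library norm is the Euclidean norm and
  whose inner product is the real part of the Hermitian one.
\<close>

definition disc_map :: "(complex^'d) set \<Rightarrow> (complex \<Rightarrow> complex^'d) \<Rightarrow> bool" where
  "disc_map \<Omega> f \<longleftrightarrow>
     f ` ball 0 1 \<subseteq> \<Omega> \<and> (\<forall>i. (\<lambda>z. f z $ i) holomorphic_on ball 0 1)"

definition cvec_deriv :: "(complex \<Rightarrow> complex^'d) \<Rightarrow> complex \<Rightarrow> complex^'d" where
  "cvec_deriv f z = (\<chi> i. deriv (\<lambda>w. f w $ i) z)"

text \<open>
  For open \<open>\<Omega>\<close> and \<open>x \<in> \<Omega>\<close> the set below is nonempty (affine discs) and bounded below by \<open>0\<close>, so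
  the infimum in the reals is the genuine one.
\<close>

definition kobayashi_metric :: "(complex^'d) set \<Rightarrow> complex^'d \<Rightarrow> complex^'d \<Rightarrow> real" where
  "kobayashi_metric \<Omega> x v =
     Inf {cmod \<zeta> | \<zeta> f. disc_map \<Omega> f \<and> f 0 = x \<and> \<zeta> *s cvec_deriv f 0 = v}"

definition abs_continuous_on :: "real \<Rightarrow> real \<Rightarrow> (real \<Rightarrow> 'a::metric_space) \<Rightarrow> bool" where
  "abs_continuous_on a b \<sigma> \<longleftrightarrow>
     (\<forall>\<epsilon>>0. \<exists>\<eta>>0. \<forall>(n::nat) l u.
        (\<forall>i<n. a \<le> l i \<and> l i \<le> u i \<and> u i \<le> b) \<and>
        disjoint_family_on (\<lambda>i. {l i<..<u i}) {..<n} \<and>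
        (\<Sum>i<n. u i - l i) < \<eta>
        \<longrightarrow> (\<Sum>i<n. dist (\<sigma> (l i)) (\<sigma> (u i))) < \<epsilon>)"

text \<open>
  The derivative of \<open>\<sigma>\<close> exists almost everywhere; its unspecified values on the exceptional null
  set do not affect the integral. The relational \<^const>\<open>has_integral\<close> keeps the default value \<open>0\<close>
  of undefined integrals out of the infimum; since the integrand is nonnegative, the integral is
  the Lebesgue one.
\<close>

definition kobayashi_dist :: "(complex^'d) set \<Rightarrow> complex^'d \<Rightarrow> complex^'d \<Rightarrow> real" where
  "kobayashi_dist \<Omega> x y =
     Inf {L. \<exists>\<sigma> a b. a \<le> b \<and> abs_continuous_on a b \<sigma> \<and> \<sigma> ` {a..b} \<subseteq> \<Omega> \<and> \<sigma> a = x \<and> \<sigma> b = y \<and>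
            ((\<lambda>t. kobayashi_metric \<Omega> (\<sigma> t) (vector_derivative \<sigma> (at t))) has_integral L) {a..b}}"

definition boundary_dist :: "'a::metric_space set \<Rightarrow> 'a \<Rightarrow> real" where
  "boundary_dist \<Omega> q = infdist q (frontier \<Omega>)"

definition alpha_regular :: "real \<Rightarrow> (complex^'d) set \<Rightarrow> bool" where
  "alpha_regular \<alpha> \<Omega> \<longleftrightarrow>
     (\<forall>z\<^sub>0\<in>\<Omega>. \<exists>B>0. \<forall>q\<in>\<Omega>.
        kobayashi_dist \<Omega> q z\<^sub>0 \<le> B + \<alpha> / 2 * ln (1 / boundary_dist \<Omega> q))"

definition alpha_star :: "(complex^'d) set \<Rightarrow> real" where
  "alpha_star \<Omega> = Inf {\<alpha>. \<alpha> > 0 \<and> alpha_regular \<alpha> \<Omega>}"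

text \<open>
  Near each boundary point, \<open>\<Omega>\<close> is a sublevel set of a real \<open>C\<^sup>1\<close> function \<open>r\<close> with nowhere
  vanishing gradient \<open>g\<close>; for open \<open>\<Omega>\<close> this forces \<open>\<partial>\<Omega> \<inter> U = {x \<in> U. r x = 0}\<close>.
\<close>

definition C1_boundary :: "'a::euclidean_space set \<Rightarrow> bool" where
  "C1_boundary \<Omega> \<longleftrightarrow>
     (\<forall>p\<in>frontier \<Omega>. \<exists>U r g. open U \<and> p \<in> U \<and>
        (\<forall>x\<in>U. (r has_derivative (\<lambda>h. g x \<bullet> h)) (at x) \<and> g x \<noteq> 0) \<and>
        continuous_on U g \<and>
        \<Omega> \<inter> U = {x\<in>U. r x < (0::real)})"

end

theory Submission
  imports Defs "HOL-Complex_Analysis.Complex_Analysis"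
begin

text \<open>
  Lower bound: a supporting real hyperplane of the convex domain bounds the Kobayashi metric below by
  the hyperbolic metric of a half-plane, so every admissible curve from \<open>q\<close> has length at least
  half the logarithmic decay of the supporting functional. Integrating along an absolutely continuous
  curve needs its almost everywhere differentiability, obtained here from Vitali coverings without
  passing through total variation.

  Upper bound: near a \<open>C\<^sup>1\<close> boundary point with inner normal \<open>n\<close>, the disc
  \<open>z \<mapsto> p + s (1 + r z) / (1 - r z) n\<close> stays in \<open>\<Omega>\<close> for every \<open>p \<in> closure \<Omega>\<close> nearby, every
  \<open>r < 1\<close> and all small \<open>s\<close>, which gives the metric bound \<open>1 / (2 r s)\<close> on the ray from \<open>p\<close>.
  Take \<open>r = 1 / (1 + \<epsilon>)\<close> and \<open>p = q - \<delta>(q) n\<close>, follow the ray from \<open>q\<close> to a fixed depth and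
  then a segment to the base point; compactness of \<open>closure \<Omega>\<close> makes the constant uniform.
\<close>

section \<open>Absolutely continuous functions of a real variable\<close>

lemma sum_increments_division:
  fixes f :: "real \<Rightarrow> 'a::real_normed_vector"
  assumes "d division_of {u..v}" "u \<le> v"
  shows "(\<Sum>K\<in>d. f (Sup K) - f (Inf K)) = f v - f u"
proof -
  note D = division_ofD[OF assms(1)]
  let ?t = "(\<lambda>K. (Inf K, K)) ` d"
  have I: "Inf K \<in> K" if "K \<in> d" for K
    using D(3)[OF that] D(4)[OF that] by fastforce
  have "?t tagged_division_of {u..v}"
    unfolding tagged_division_of
  proof (intro conjI allI impI)
    have "{K. \<exists>x. (x, K) \<in> ?t} = d" by auto
    then show "\<Union>{K. \<exists>x. (x, K) \<in> ?t} = {u..v}" using D(6) by simp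
    fix x1 K1 x2 K2
    assume "(x1, K1) \<in> ?t \<and> (x2, K2) \<in> ?t \<and> (x1, K1) \<noteq> (x2, K2)"
    then show "interior K1 \<inter> interior K2 = {}" using D(5) by blast
  qed (use D I in \<open>auto simp: image_iff\<close>)
  then have "(\<Sum>(x,K)\<in>?t. f (Sup K) - f (Inf K)) = f v - f u"
    using additive_tagged_division_1[OF \<open>u \<le> v\<close>] by blast
  then show ?thesis
    by (subst (asm) sum.reindex) (auto simp: inj_on_def)
qed

lemma abs_continuous_on_division:
  assumes "abs_continuous_on a b f" "0 < e"
  obtains \<eta> where "0 < \<eta>"
    "\<And>D. D division_of \<Union>D \<Longrightarrow> \<Union>D \<subseteq> {a..b} \<Longrightarrow> (\<Sum>K\<in>D. Sup K - Inf K) < \<eta> \<Longrightarrow>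
       (\<Sum>K\<in>D. dist (f (Inf K)) (f (Sup K))) < e"
proof -
  obtain \<eta> where \<eta>: "\<eta> > 0" and AC: "\<And>(n::nat) l u.
        (\<forall>i<n. a \<le> l i \<and> l i \<le> u i \<and> u i \<le> b) \<Longrightarrow>
        disjoint_family_on (\<lambda>i. {l i<..<u i}) {..<n} \<Longrightarrow>
        (\<Sum>i<n. u i - l i) < \<eta>
        \<Longrightarrow> (\<Sum>i<n. dist (f (l i)) (f (u i))) < e"
    using assms unfolding abs_continuous_on_def by meson
  show thesis
  proof (rule that[OF \<eta>])
    fix D assume div: "D division_of \<Union>D" and sub: "\<Union>D \<subseteq> {a..b}" and con: "(\<Sum>K\<in>D. Sup K - Inf K) < \<eta>"
    note D = division_ofD[OF div]
    obtain h where h: "bij_betw h {..<card D} D"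
      using ex_bij_betw_nat_finite[OF D(1)] by (auto simp: lessThan_atLeast0)
    have K: "K = {Inf K..Sup K} \<and> Inf K \<le> Sup K \<and> a \<le> Inf K \<and> Sup K \<le> b"
      if K: "K \<in> D" for K
    proof -
      obtain u v where "K = cbox u v" using D(4) K by blast
      then show ?thesis using D(3)[OF K] K sub by fastforce
    qed
    have hD: "h i \<in> D" if "i < card D" for i using h that by (auto simp: bij_betw_def)
    have "(\<Sum>i<card D. dist (f (Inf (h i))) (f (Sup (h i)))) < e"
    proof (rule AC)
      show "\<forall>i<card D. a \<le> Inf (h i) \<and> Inf (h i) \<le> Sup (h i) \<and> Sup (h i) \<le> b"
        using K hD by blast
      have "{Inf (h i)<..<Sup (h i)} = interior (h i)" if "i < card D" for i
        using K[OF hD[OF that]] interior_atLeastAtMost_real by metis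
      moreover have "interior (h i) \<inter> interior (h j) = {}" if "i < card D" "j < card D" "i \<noteq> j" for i j
        using D(5)[OF hD[OF that(1)] hD[OF that(2)]] h that by (auto simp: bij_betw_def inj_on_def)
      ultimately show "disjoint_family_on (\<lambda>i. {Inf (h i)<..<Sup (h i)}) {..<card D}"
        by (auto simp: disjoint_family_on_def)
      show "(\<Sum>i<card D. Sup (h i) - Inf (h i)) < \<eta>"
        using con sum.reindex_bij_betw[OF h, of "\<lambda>K. Sup K - Inf K"] by simp
    qed
    then show "(\<Sum>K\<in>D. dist (f (Inf K)) (f (Sup K))) < e"
      using sum.reindex_bij_betw[OF h, of "\<lambda>K. dist (f (Inf K)) (f (Sup K))"] by simp
  qed
qed

lemma Vitali_finite_intervals:
  fixes S :: "real set"
  assumes G: "open G" "G \<in> lmeasurable" "S \<subseteq> G" and "0 < e"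
    and cov: "\<And>x d. x \<in> S \<Longrightarrow> 0 < d \<Longrightarrow> \<exists>u v. u < v \<and> u \<le> x \<and> x \<le> v \<and> v - u < d \<and> P u v"
  obtains D T where "finite D" "pairwise disjnt D"
    "\<And>K. K \<in> D \<Longrightarrow> K \<subseteq> G \<and> (\<exists>u v. u < v \<and> K = {u..v} \<and> P u v)"
    "D division_of \<Union>D" "S \<subseteq> \<Union>D \<union> T" "T \<in> lmeasurable" "measure lebesgue T < e"
proof -
  define N where "N = {(u,v). u < v \<and> {u..v} \<subseteq> G \<and> P u v}"
  define c r where "c = (\<lambda>(u::real,v). (u+v)/2)" and "r = (\<lambda>(u::real,v). (v-u)/2)"
  have cb: "cball (c i) (r i) = {fst i..snd i}" for i
    by (auto simp: c_def r_def cball_eq_atLeastAtMost split: prod.splits) (auto simp: field_simps)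
  obtain C where C: "countable C" "C \<subseteq> N" 
     "pairwise (\<lambda>i j. disjnt (cball (c i) (r i)) (cball (c j) (r j))) C"
     "negligible(S - (\<Union>i \<in> C. cball (c i) (r i)))"
  proof (rule Vitali_covering_theorem_cballs[of N r S c])
    show "0 < r i" if "i \<in> N" for i using that by (auto simp: N_def r_def)
    fix x d :: real assume "x \<in> S" "0 < d"
    obtain d' where d': "d' > 0" "ball x d' \<subseteq> G" using G \<open>x \<in> S\<close> openE by blast
    obtain u v where uv: "u < v" "u \<le> x" "x \<le> v" "v - u < min d d'" "P u v"
      using cov[OF \<open>x \<in> S\<close>, of "min d d'"] \<open>0 < d\<close> d' by auto
    have "{u..v} \<subseteq> ball x d'" using uv by (auto simp: dist_real_def)
    then have "(u,v) \<in> N" using uv d' by (auto simp: N_def)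
    then show "\<exists>i. i \<in> N \<and> x \<in> cball (c i) (r i) \<and> r i < d"
      using uv unfolding cb by (intro exI[of _ "(u,v)"]) (auto simp: r_def)
  qed
  define \<D> where "\<D> = (\<lambda>i. {fst i..snd i}) ` C"
  have D: "\<exists>u v. u < v \<and> K = {u..v} \<and> P u v" "K \<subseteq> G" if K: "K \<in> \<D>" for K
  proof -
    obtain u v where "(u,v) \<in> N" "K = {u..v}" using K C(2) by (auto simp: \<D>_def)
    then show "\<exists>u v. u < v \<and> K = {u..v} \<and> P u v" "K \<subseteq> G" by (auto simp: N_def)
  qed
  have lm: "K \<in> lmeasurable" if "K \<in> \<D>" for K using D[OF that] by auto
  have dis: "pairwise disjnt \<D>"
    using C(3) unfolding cb \<D>_def pairwise_def by auto
  have GD: "\<Union>\<D> \<subseteq> G" using D by blast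
  have UD: "\<Union>\<D> \<in> lmeasurable"
    using C(1) lm by (intro fmeasurableI2[OF G(2) GD] sets.countable_Union) (auto simp: \<D>_def)
  obtain D' where D': "D' \<subseteq> \<D>" "finite D'" "measure lebesgue (\<Union>\<D>) - e < measure lebesgue (\<Union>D')"
  proof (rule measure_countable_Union_approachable[of \<D> e "measure lebesgue G"])
    show "countable \<D>" using C by (auto simp: \<D>_def)
    fix D' assume "D' \<subseteq> \<D>" "finite D'"
    then show "measure lebesgue (\<Union>D') \<le> measure lebesgue G"
      using GD lm G by (intro measure_mono_fmeasurable) (auto intro!: sets.finite_Union)
  qed (use lm \<open>0 < e\<close> in auto)
  have UD': "\<Union>D' \<in> lmeasurable"
    using D' lm by (intro fmeasurable.finite_Union) auto
  let ?T = "(\<Union>\<D> - \<Union>D') \<union> (S - \<Union>\<D>)"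
  have neg: "negligible (S - \<Union>\<D>)" using C(4) unfolding cb \<D>_def by simp
  show thesis
  proof (rule that[of D' ?T])
    show "pairwise disjnt D'" using dis D'(1) pairwise_subset by blast
    show "D' division_of \<Union>D'"
      unfolding division_of_def
    proof (intro conjI ballI impI)
      fix K assume "K \<in> D'"
      then obtain u v where "u < v" "K = {u..v}" using D D' by blast
      then show "K \<noteq> {}" "\<exists>a b. K = cbox a b" by auto
    next
      fix K1 K2 assume "K1 \<in> D'" "K2 \<in> D'" "K1 \<noteq> K2"
      then have "K1 \<inter> K2 = {}" using dis D'(1) by (auto simp: pairwise_def disjnt_def)
      then show "interior K1 \<inter> interior K2 = {}" using interior_subset by blast
    qed (use D' in auto)
    show "S \<subseteq> \<Union>D' \<union> ?T" by blast
    have 1: "\<Union>\<D> - \<Union>D' \<in> lmeasurable" using UD UD' by blast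
    then show "?T \<in> lmeasurable" using neg negligible_imp_measurable by blast
    have "measure lebesgue ?T \<le> measure lebesgue (\<Union>\<D> - \<Union>D') + measure lebesgue (S - \<Union>\<D>)"
      using 1 neg negligible_imp_measurable by (intro measure_Un_le) auto
    also have "\<dots> = measure lebesgue (\<Union>\<D>) - measure lebesgue (\<Union>D')"
      using neg negligible_imp_measure0 UD UD' D'(1)
      by (subst measurable_measure_Diff) auto
    also have "\<dots> < e" using D' by simp
    finally show "measure lebesgue ?T < e" .
  qed (use D D' in auto)
qed

lemma measure_division_real:
  fixes D :: "real set set"
  assumes "D division_of \<Union>D"
  shows "measure lebesgue (\<Union>D) = (\<Sum>K\<in>D. Sup K - Inf K)"
proof -
  note D = division_ofD[OF assms]
  have "measure lebesgue (\<Union>D) = (\<Sum>K\<in>D. measure lebesgue K)"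
  proof (rule measure_negligible_finite_Union[OF D(1)])
    show "K \<in> lmeasurable" if "K \<in> D" for K using D(4)[OF that] by auto
    show "pairwise (\<lambda>S T. negligible (S \<inter> T)) D"
    proof (clarsimp simp: pairwise_def)
      fix K L assume KL: "K \<in> D" "L \<in> D" "K \<noteq> L"
      obtain k1 k2 l1 l2 where "K = cbox k1 k2" "L = cbox l1 l2" using D(4) KL by meson
      then have KL': "K \<inter> L = cbox (max k1 l1) (min k2 l2)" by auto
      have "interior (K \<inter> L) = {}" using D(5)[OF KL] by simp
      then show "negligible (K \<inter> L)"
        unfolding KL' negligible_interval interior_cbox .
    qed
  qed
  also have "\<dots> = (\<Sum>K\<in>D. Sup K - Inf K)"
  proof (rule sum.cong)
    fix K assume K: "K \<in> D"
    then obtain u v where "K = cbox u v" using D(4) by blast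
    then show "measure lebesgue K = Sup K - Inf K" using D(3)[OF K] by auto
  qed simp
  finally show ?thesis .
qed

lemma division_refine_remainder:
  fixes D E :: "real set set"
  assumes D: "D division_of \<Union>D" "pairwise disjnt D"
    and E: "E division_of \<Union>E" and sub: "\<And>J. J \<in> E \<Longrightarrow> \<exists>K\<in>D. J \<subseteq> K"
  obtains R where "R division_of \<Union>R" "\<Union>R \<subseteq> \<Union>D"
    "\<And>f::real \<Rightarrow> real. (\<Sum>K\<in>D. f (Sup K) - f (Inf K)) =
        (\<Sum>K\<in>E. f (Sup K) - f (Inf K)) + (\<Sum>K\<in>R. f (Sup K) - f (Inf K))"
proof -
  note DD = division_ofD[OF D(1)] and EE = division_ofD[OF E]
  define H where "H = (\<lambda>K. {J\<in>E. J \<subseteq> K})"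
  have "\<exists>q. H K \<subseteq> q \<and> q division_of K" if K: "K \<in> D" for K
  proof -
    obtain u v where uv: "K = cbox u v" using DD(4) K by blast
    have "H K \<subseteq> E" by (auto simp: H_def)
    then have "H K division_of \<Union>(H K)" using E division_of_subset by blast
    then show ?thesis 
      using partial_division_extend_interval[of "H K" u v] uv by (metis (no_types, lifting) H_def Union_least mem_Collect_eq)
  qed
  then obtain q where q: "\<And>K. K \<in> D \<Longrightarrow> H K \<subseteq> q K" "\<And>K. K \<in> D \<Longrightarrow> q K division_of K"
    by metis
  note Q = division_ofD[OF q(2)]
  define R where "R = (\<Union>K\<in>D. q K - H K)"
  have sing: "K1 = K2" if "K1 \<in> D" "K2 \<in> D" "J \<subseteq> K1" "J \<subseteq> K2" "J \<noteq> {}" for J K1 K2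
    using D(2) that unfolding pairwise_def disjnt_def by blast
  have HE: "(\<Union>K\<in>D. H K) = E" using sub by (auto simp: H_def)
  have Rdiv: "R division_of \<Union>R"
    unfolding division_of_def
  proof (intro conjI ballI impI)
    show "finite R" unfolding R_def using DD(1) Q(1) by auto
    fix K assume "K \<in> R" then obtain K0 where "K0 \<in> D" "K \<in> q K0" by (auto simp: R_def)
    then show "K \<noteq> {}" "\<exists>a b. K = cbox a b" using Q(3,4) by blast+
  next
    fix J1 J2 assume J: "J1 \<in> R" "J2 \<in> R" "J1 \<noteq> J2"
    obtain K1 K2 where K: "K1 \<in> D" "K2 \<in> D" "J1 \<in> q K1" "J2 \<in> q K2" using J by (auto simp: R_def)
    show "interior J1 \<inter> interior J2 = {}"
    proof (cases "K1 = K2")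
      case True then show ?thesis using Q(5) K J by blast
    next
      case False
      then have "K1 \<inter> K2 = {}" using D(2) K by (auto simp: pairwise_def disjnt_def)
      moreover have "J1 \<subseteq> K1" "J2 \<subseteq> K2" using Q(2) K by auto
      ultimately show ?thesis using interior_subset by blast
    qed
  qed auto
  show thesis
  proof (rule that[OF Rdiv])
    show "\<Union>R \<subseteq> \<Union>D" using Q(2) by (fastforce simp: R_def)
    fix f :: "real \<Rightarrow> real"
    let ?d = "\<lambda>K. f (Sup K) - f (Inf K)"
    have "sum ?d D = (\<Sum>K\<in>D. sum ?d (q K))"
    proof (rule sum.cong)
      fix K assume K: "K \<in> D"
      then obtain u v where uv: "K = cbox u v" "u \<le> v" using DD(4)[OF K] DD(3)[OF K] by fastforce
      then show "?d K = sum ?d (q K)"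
        using sum_increments_division[of "q K" u v f] q(2)[OF K] by simp
    qed simp
    also have "\<dots> = (\<Sum>K\<in>D. sum ?d (H K) + sum ?d (q K - H K))"
    proof (rule sum.cong[OF refl])
      fix K assume K: "K \<in> D"
      show "sum ?d (q K) = sum ?d (H K) + sum ?d (q K - H K)"
        using sum.subset_diff[OF q(1)[OF K] Q(1)[OF K], of ?d] by (simp only: add.commute)
    qed
    also have "\<dots> = (\<Sum>K\<in>D. sum ?d (H K)) + (\<Sum>K\<in>D. sum ?d (q K - H K))"
      by (rule sum.distrib)
    also have "(\<Sum>K\<in>D. sum ?d (H K)) = sum ?d E"
      unfolding HE[symmetric]
    proof (rule sum.UNION_disjoint[symmetric])
      show "\<forall>K\<in>D. \<forall>K'\<in>D. K \<noteq> K' \<longrightarrow> H K \<inter> H K' = {}"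
        using sing EE(3) unfolding H_def by blast
    qed (use DD EE in \<open>auto simp: H_def\<close>)
    also have "(\<Sum>K\<in>D. sum ?d (q K - H K)) = sum ?d R"
      unfolding R_def
    proof (rule sum.UNION_disjoint[symmetric])
      have "False" if "K \<in> D" "K' \<in> D" "K \<noteq> K'" "J \<in> q K" "J \<in> q K'" for K K' J
        using sing[of K K' J] Q(2)[of K J] Q(2)[of K' J] Q(3)[of K J] that by blast
      then show "\<forall>K\<in>D. \<forall>K'\<in>D. K \<noteq> K' \<longrightarrow> (q K - H K) \<inter> (q K' - H K') = {}"
        by blast
    qed (use DD Q in auto)
    finally show "sum ?d D = sum ?d E + sum ?d R" .
  qed
qed

lemma lmeasurable_outer_open_less:
  fixes S :: "'a::euclidean_space set"
  assumes "S \<in> lmeasurable" "e > 0"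
  obtains G where "open G" "S \<subseteq> G" "G \<in> lmeasurable" "measure lebesgue G < measure lebesgue S + e"
proof -
  obtain G where G: "open G" "S \<subseteq> G" "G - S \<in> lmeasurable" "emeasure lebesgue (G - S) < ennreal e"
    using sets_lebesgue_outer_open[of S e] assms by (metis fmeasurableD)
  have m: "measure lebesgue (G - S) < e"
    using G assms by (simp add: emeasure_eq_measure2 ennreal_less_iff)
  have "G = S \<union> (G - S)" using G by auto
  then have "G \<in> lmeasurable" "measure lebesgue G \<le> measure lebesgue S + measure lebesgue (G - S)"
    using assms(1) G(3) by (metis fmeasurable.Un, metis measure_Un_le fmeasurableD)
  then show thesis using that[OF G(1,2)] m by linarith
qed

text \<open>
  Cover \<open>S\<close> up to small measure by intervals \<open>D\<close> of slope below \<open>p\<close>, and then by intervals \<open>E\<close> inside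
  them of slope above \<open>q\<close>. The total lengths almost agree, so by absolute continuity the part of
  \<open>\<Union>D\<close> outside \<open>\<Union>E\<close> hardly contributes to the increments of \<open>f\<close>, which forces \<open>S\<close> to be null.
\<close>

lemma negligible_two_slopes:
  fixes f :: "real \<Rightarrow> real"
  assumes AC: "abs_continuous_on a b f" and "p < q" and S: "S \<subseteq> {a<..<b}"
    and low: "\<And>x d. x \<in> S \<Longrightarrow> 0 < d \<Longrightarrow>
      \<exists>u v. u < v \<and> u \<le> x \<and> x \<le> v \<and> v - u < d \<and> f v - f u < p * (v - u)"
    and upp: "\<And>x d. x \<in> S \<Longrightarrow> 0 < d \<Longrightarrow>
      \<exists>u v. u < v \<and> u \<le> x \<and> x \<le> v \<and> v - u < d \<and> f v - f u > q * (v - u)"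
  shows "negligible S"
proof (rule ccontr)
  assume "\<not> negligible S"
  define M where "M = measure lebesgue ` {T. T \<in> lmeasurable \<and> S \<subseteq> T}"
  define m where "m = Inf M"
  have Mne: "M \<noteq> {}" using S by (auto simp: M_def intro!: exI[of _ "{a<..<b}"])
  have Mb: "bdd_below M" by (rule bdd_belowI[of _ 0]) (auto simp: M_def)
  have mle: "m \<le> measure lebesgue T" if "T \<in> lmeasurable" "S \<subseteq> T" for T
    unfolding m_def using that Mb by (intro cInf_lower) (auto simp: M_def)
  have mex: "\<exists>T. T \<in> lmeasurable \<and> S \<subseteq> T \<and> measure lebesgue T < m + e" if "e > 0" for e
    using cInf_lessD[OF Mne, of "m + e"] that by (auto simp: M_def m_def)
  have "m > 0"
  proof (rule ccontr)
    assume "\<not> m > 0"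
    then have "\<exists>T. S \<subseteq> T \<and> T \<in> lmeasurable \<and> measure lebesgue T < e" if "e > 0" for e
    proof -
      obtain T where "T \<in> lmeasurable" "S \<subseteq> T" "measure lebesgue T < m + e"
        using mex[OF \<open>e > 0\<close>] by blast
      then show ?thesis using \<open>\<not> m > 0\<close> by (intro exI[of _ T]) auto
    qed
    then show False using \<open>\<not> negligible S\<close> by (simp add: negligible_outer)
  qed
  define e where "e = (q - p) * m / 4"
  have "e > 0" using \<open>m > 0\<close> \<open>p < q\<close> by (simp add: e_def)
  obtain \<eta>' where \<eta>': "0 < \<eta>'"
    "\<And>D. D division_of \<Union>D \<Longrightarrow> \<Union>D \<subseteq> {a..b} \<Longrightarrow> (\<Sum>K\<in>D. Sup K - Inf K) < \<eta>' \<Longrightarrow>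
       (\<Sum>K\<in>D. dist (f (Inf K)) (f (Sup K))) < e"
    using abs_continuous_on_division[OF AC \<open>e > 0\<close>] by blast
  define \<eta> where "\<eta> = min (\<eta>' / 8) (min (m / 8) (e / (4 * (\<bar>p\<bar> + 1))))"
  have \<eta>: "\<eta> > 0" "4 * \<eta> < \<eta>'" "\<eta> \<le> m / 8" "\<eta> \<le> e / (4 * (\<bar>p\<bar> + 1))"
    using \<eta>' \<open>m > 0\<close> \<open>e > 0\<close> unfolding \<eta>_def
    by (linarith | simp add: add_nonneg_pos)+
  have "\<eta> * (4 * (\<bar>p\<bar> + 1)) \<le> e" using \<eta>(4) by (simp add: pos_le_divide_eq)
  then have p\<eta>: "4 * \<bar>p\<bar> * \<eta> \<le> e" using \<eta>(1) by (simp add: algebra_simps)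
  obtain T where T: "T \<in> lmeasurable" "S \<subseteq> T" "measure lebesgue T < m + \<eta> / 2"
    using mex[of "\<eta>/2"] \<eta> by auto
  obtain G0 where G0: "open G0" "T \<subseteq> G0" "G0 \<in> lmeasurable" "measure lebesgue G0 < m + \<eta>"
    using lmeasurable_outer_open_less[OF T(1), of "\<eta> / 2"] \<eta> T by (smt (verit) field_sum_of_halves half_gt_zero)
  define G where "G = G0 \<inter> {a<..<b}"
  have G: "open G" "S \<subseteq> G" "G \<in> lmeasurable" "G \<subseteq> {a..b}"
    using G0 T S by (auto simp: G_def)
  have "measure lebesgue G \<le> measure lebesgue G0"
    using G0 G by (intro measure_mono_fmeasurable) (auto simp: G_def)
  then have mG: "measure lebesgue G < m + \<eta>" using G0 by simp
  obtain D T1 where D: "finite D" "pairwise disjnt D"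
    "\<And>K. K \<in> D \<Longrightarrow> K \<subseteq> G \<and> (\<exists>u v. u < v \<and> K = {u..v} \<and> f v - f u < p * (v - u))"
    "D division_of \<Union>D" "S \<subseteq> \<Union>D \<union> T1" "T1 \<in> lmeasurable" "measure lebesgue T1 < \<eta>"
    by (rule Vitali_finite_intervals[where P = "\<lambda>u v. f v - f u < p * (v - u)", OF G(1,3,2) \<eta>(1) low])
      ((assumption | rule that; (assumption | blast))+)
  define G2 where "G2 = (\<Union>K\<in>D. interior K)"
  have G2sub: "G2 \<subseteq> G" using D(3) interior_subset by (fastforce simp: G2_def)
  have G2: "open G2" "G2 \<in> lmeasurable" 
  proof -
    show "open G2" by (auto simp: G2_def)
    then show "G2 \<in> lmeasurable" using fmeasurableI2[OF G(3) G2sub] by simp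
  qed
  have cov2: "\<exists>u v. u < v \<and> u \<le> x \<and> x \<le> v \<and> v - u < d \<and> (f v - f u > q * (v - u) \<and> (\<exists>K\<in>D. {u..v} \<subseteq> K))"
    if x: "x \<in> S \<inter> G2" and d: "0 < d" for x d
  proof -
    obtain K where K: "K \<in> D" "x \<in> interior K" using x by (auto simp: G2_def)
    then obtain r where r: "r > 0" "ball x r \<subseteq> K" by (metis mem_interior)
    obtain u v where uv: "u < v" "u \<le> x" "x \<le> v" "v - u < min d r" "f v - f u > q * (v - u)"
      using upp[of x "min d r"] x d r by auto
    have "{u..v} \<subseteq> ball x r" using uv by (auto simp: dist_real_def)
    then show ?thesis using uv r K by (intro exI[of _ u] exI[of _ v]) auto
  qed
  obtain E T2 where E: "finite E" "pairwise disjnt E"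
    "\<And>K. K \<in> E \<Longrightarrow> K \<subseteq> G2 \<and> (\<exists>u v. u < v \<and> K = {u..v} \<and> (f v - f u > q * (v - u) \<and> (\<exists>K\<in>D. {u..v} \<subseteq> K)))"
    "E division_of \<Union>E" "S \<inter> G2 \<subseteq> \<Union>E \<union> T2" "T2 \<in> lmeasurable" "measure lebesgue T2 < \<eta>"
  proof (rule Vitali_finite_intervals[where P = "\<lambda>u v. f v - f u > q * (v - u) \<and> (\<exists>K\<in>D. {u..v} \<subseteq> K)",
          OF G2(1,2) inf_le2 \<eta>(1)])
    show "\<exists>u v. u < v \<and> u \<le> x \<and> x \<le> v \<and> v - u < d \<and> (f v - f u > q * (v - u) \<and> (\<exists>K\<in>D. {u..v} \<subseteq> K))"
      if "x \<in> S \<inter> G2" "0 < d" for x d using cov2[OF that] .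
  qed (rule that)
  obtain R where R: "R division_of \<Union>R" "\<Union>R \<subseteq> \<Union>D"
    "\<And>f::real \<Rightarrow> real. (\<Sum>K\<in>D. f (Sup K) - f (Inf K)) =
        (\<Sum>K\<in>E. f (Sup K) - f (Inf K)) + (\<Sum>K\<in>R. f (Sup K) - f (Inf K))"
  proof (rule division_refine_remainder[OF D(4,2) E(4)])
    show "\<exists>K\<in>D. J \<subseteq> K" if "J \<in> E" for J using E(3)[OF that] by blast
  qed (rule that)
  define lD lE lR where "lD = (\<Sum>K\<in>D. Sup K - Inf K)" and "lE = (\<Sum>K\<in>E. Sup K - Inf K)"
    and "lR = (\<Sum>K\<in>R. Sup K - Inf K)"
  have lDER: "lD = lE + lR" using R(3)[of "\<lambda>x. x"] by (simp add: lD_def lE_def lR_def)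
  have UD: "\<Union>D \<in> lmeasurable" "\<Union>E \<in> lmeasurable" 
    using D(4) E(4) lmeasurable_division by blast+
  have "lD \<le> measure lebesgue G"
    unfolding lD_def measure_division_real[OF D(4), symmetric]
    using UD D(3) G by (intro measure_mono_fmeasurable) auto
  then have lD: "lD < m + \<eta>" using mG by simp
  have neg: "negligible (\<Union>D - G2)"
  proof (rule negligible_subset)
    show "\<Union>D - G2 \<subseteq> (\<Union>K\<in>D. K - interior K)" by (auto simp: G2_def)
    have "negligible (K - interior K)" if "K \<in> D" for K
      using D(3)[OF that] by (auto simp: atLeastAtMost_diff_ends)
    then show "negligible (\<Union>K\<in>D. K - interior K)" using D(1) by (intro negligible_Union) auto
  qed
  have cov: "S \<subseteq> \<Union>E \<union> (T1 \<union> T2) \<union> (\<Union>D - G2)" using D(5) E(5) by blast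
  have lm: "T1 \<union> T2 \<in> lmeasurable" "\<Union>E \<union> (T1 \<union> T2) \<in> lmeasurable" "\<Union>D - G2 \<in> lmeasurable"
    using UD D(6) E(6) negligible_imp_measurable[OF neg] by (simp_all add: fmeasurable.Un)
  have "m \<le> measure lebesgue (\<Union>E \<union> (T1 \<union> T2) \<union> (\<Union>D - G2))"
    using cov by (intro mle fmeasurable.Un lm)
  also have "\<dots> \<le> measure lebesgue (\<Union>E \<union> (T1 \<union> T2)) + measure lebesgue (\<Union>D - G2)"
    by (intro measure_Un_le fmeasurableD lm)
  also have "\<dots> = measure lebesgue (\<Union>E \<union> (T1 \<union> T2))" by (simp add: negligible_imp_measure0[OF neg])
  also have "\<dots> \<le> measure lebesgue (\<Union>E) + measure lebesgue (T1 \<union> T2)"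
    by (intro measure_Un_le fmeasurableD lm UD)
  also have "measure lebesgue (T1 \<union> T2) \<le> measure lebesgue T1 + measure lebesgue T2"
    by (intro measure_Un_le fmeasurableD D(6) E(6))
  also have "measure lebesgue (\<Union>E) = lE" unfolding lE_def by (rule measure_division_real[OF E(4)])
  finally have lE: "lE > m - 2 * \<eta>" using D(7) E(7) by simp
  have lR: "lR < \<eta>'" using lDER lD lE \<eta> by simp
  have "\<Union>R \<subseteq> {a..b}" using R(2) D(3) G(4) by blast
  have "\<bar>\<Sum>K\<in>R. f (Sup K) - f (Inf K)\<bar> \<le> (\<Sum>K\<in>R. dist (f (Inf K)) (f (Sup K)))"
    by (rule order_trans[OF sum_abs]) (auto simp: dist_real_def intro!: sum_mono)
  also have "\<dots> < e" using \<eta>'(2)[OF R(1) \<open>\<Union>R \<subseteq> {a..b}\<close>] lR by (simp add: lR_def)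
  finally have fR: "(\<Sum>K\<in>R. f (Sup K) - f (Inf K)) > - e" by simp
  have fD: "(\<Sum>K\<in>D. f (Sup K) - f (Inf K)) \<le> p * lD"
    unfolding lD_def sum_distrib_left
  proof (rule sum_mono)
    fix K assume "K \<in> D"
    then show "f (Sup K) - f (Inf K) \<le> p * (Sup K - Inf K)" using D(3)[OF \<open>K \<in> D\<close>] by fastforce
  qed
  have fE: "(\<Sum>K\<in>E. f (Sup K) - f (Inf K)) \<ge> q * lE"
    unfolding lE_def sum_distrib_left
  proof (rule sum_mono)
    fix K assume "K \<in> E"
    then show "f (Sup K) - f (Inf K) \<ge> q * (Sup K - Inf K)" using E(3) by fastforce
  qed
  have "q * lE - e < p * lD" using fD fE fR R(3)[of f] by simp
  moreover have "p * lD \<le> p * lE + \<bar>p\<bar> * (3 * \<eta>)"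
  proof -
    have "0 \<le> lR" using measure_division_real[OF R(1)] by (simp add: lR_def flip: measure_division_real[OF R(1)])
    moreover have "lR \<le> 3 * \<eta>" using lDER lD lE by simp
    ultimately have "p * lR \<le> \<bar>p\<bar> * (3 * \<eta>)" by (intro mult_mono) auto
    then show ?thesis by (simp add: lDER algebra_simps)
  qed
  moreover have "(q - p) * lE = q * lE - p * lE" by (simp add: algebra_simps)
  moreover have "\<bar>p\<bar> * (3 * \<eta>) \<le> 4 * \<bar>p\<bar> * \<eta>" using \<eta>(1) by (simp add: algebra_simps)
  ultimately have "(q - p) * lE < e + 4 * \<bar>p\<bar> * \<eta>" by linarith
  also have "\<dots> \<le> 2 * e" using p\<eta> by simp
  also have "\<dots> = (q - p) * (m / 2)" by (simp add: e_def)
  finally have "lE < m / 2" using \<open>p < q\<close> by simp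
  then show False using lE \<eta> \<open>m > 0\<close> by simp
qed

lemma abs_continuous_on_lipschitz:
  assumes AC: "abs_continuous_on a b f" and "0 \<le> C"
    and lip: "\<And>s t. s \<in> {a..b} \<Longrightarrow> t \<in> {a..b} \<Longrightarrow> dist (g (f s)) (g (f t)) \<le> C * dist (f s) (f t)"
  shows "abs_continuous_on a b (\<lambda>t. g (f t))"
  unfolding abs_continuous_on_def
proof (intro allI impI)
  fix e :: real assume "e > 0"
  then have "e / (C + 1) > 0" using \<open>0 \<le> C\<close> by simp
  then obtain \<eta> where \<eta>: "\<eta> > 0" "\<And>(n::nat) l u.
        (\<forall>i<n. a \<le> l i \<and> l i \<le> u i \<and> u i \<le> b) \<and>
        disjoint_family_on (\<lambda>i. {l i<..<u i}) {..<n} \<and>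
        (\<Sum>i<n. u i - l i) < \<eta> \<Longrightarrow> (\<Sum>i<n. dist (f (l i)) (f (u i))) < e / (C + 1)"
    using AC unfolding abs_continuous_on_def by blast
  show "\<exists>\<eta>>0. \<forall>(n::nat) l u.
        (\<forall>i<n. a \<le> l i \<and> l i \<le> u i \<and> u i \<le> b) \<and>
        disjoint_family_on (\<lambda>i. {l i<..<u i}) {..<n} \<and>
        (\<Sum>i<n. u i - l i) < \<eta> \<longrightarrow> (\<Sum>i<n. dist (g (f (l i))) (g (f (u i)))) < e"
  proof (intro exI[of _ \<eta>] conjI allI impI \<eta>(1))
    fix n :: nat and l u :: "nat \<Rightarrow> real"
    assume H: "(\<forall>i<n. a \<le> l i \<and> l i \<le> u i \<and> u i \<le> b) \<and>
        disjoint_family_on (\<lambda>i. {l i<..<u i}) {..<n} \<and> (\<Sum>i<n. u i - l i) < \<eta>"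
    have "(\<Sum>i<n. dist (g (f (l i))) (g (f (u i)))) \<le> (\<Sum>i<n. (C + 1) * dist (f (l i)) (f (u i)))"
    proof (rule sum_mono)
      fix i assume "i \<in> {..<n}"
      then have "dist (g (f (l i))) (g (f (u i))) \<le> C * dist (f (l i)) (f (u i))"
        using H by (intro lip) force+
      also have "\<dots> \<le> (C + 1) * dist (f (l i)) (f (u i))" by (intro mult_right_mono) auto
      finally show "dist (g (f (l i))) (g (f (u i))) \<le> (C + 1) * dist (f (l i)) (f (u i))" .
    qed
    also have "\<dots> = (C + 1) * (\<Sum>i<n. dist (f (l i)) (f (u i)))" by (simp add: sum_distrib_left)
    also have "\<dots> < (C + 1) * (e / (C + 1))" 
      using \<eta>(2)[OF H] \<open>0 \<le> C\<close> by (intro mult_strict_left_mono) auto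
    also have "\<dots> = e" using \<open>0 \<le> C\<close> by simp
    finally show "(\<Sum>i<n. dist (g (f (l i))) (g (f (u i)))) < e" .
  qed
qed

lemma negligible_infinite_slope:
  fixes f :: "real \<Rightarrow> real"
  assumes AC: "abs_continuous_on a b f" and S: "S \<subseteq> {a<..<b}"
    and upp: "\<And>x q d. x \<in> S \<Longrightarrow> 0 < d \<Longrightarrow>
      \<exists>u v. u < v \<and> u \<le> x \<and> x \<le> v \<and> v - u < d \<and> f v - f u > q * (v - u)"
  shows "negligible S"
  unfolding locally_negligible_alt[of S]
proof
  obtain \<eta> where \<eta>: "0 < \<eta>"
    "\<And>D. D division_of \<Union>D \<Longrightarrow> \<Union>D \<subseteq> {a..b} \<Longrightarrow> (\<Sum>K\<in>D. Sup K - Inf K) < \<eta> \<Longrightarrow>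
       (\<Sum>K\<in>D. dist (f (Inf K)) (f (Sup K))) < 1"
    using abs_continuous_on_division[OF AC zero_less_one] by blast
  fix x assume "x \<in> S"
  define G where "G = ball x (\<eta> / 4) \<inter> {a<..<b}"
  have Gl: "G \<in> lmeasurable" by (auto simp: G_def)
  have "measure lebesgue G \<le> measure lebesgue (ball x (\<eta> / 4))"
    using Gl by (intro measure_mono_fmeasurable) (auto simp: G_def)
  also have "\<dots> < \<eta>" using \<eta>(1) by (simp add: ball_eq_greaterThanLessThan)
  finally have mG: "measure lebesgue G < \<eta>" .
  have "negligible (S \<inter> G)"
    unfolding negligible_outer_le
  proof (intro allI impI)
    fix e :: real assume "e > 0"
    then have "e/2 > 0" by simp
    obtain D T where D: "finite D" "pairwise disjnt D"
      "\<And>K. K \<in> D \<Longrightarrow> K \<subseteq> G \<and> (\<exists>u v. u < v \<and> K = {u..v} \<and> f v - f u > (2/e) * (v - u))"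
      "D division_of \<Union>D" "S \<inter> G \<subseteq> \<Union>D \<union> T" "T \<in> lmeasurable" "measure lebesgue T < e/2"
    proof (rule Vitali_finite_intervals[where P = "\<lambda>u v. f v - f u > (2/e) * (v - u)", OF _ Gl inf_le2 \<open>e/2 > 0\<close>])
      show "open G" by (auto simp: G_def)
      show "\<exists>u v. u < v \<and> u \<le> x \<and> x \<le> v \<and> v - u < d \<and> f v - f u > (2/e) * (v - u)"
        if "x \<in> S \<inter> G" "0 < d" for x d using upp that by blast
    qed (rule that)
    define lD where "lD = (\<Sum>K\<in>D. Sup K - Inf K)"
    have UD: "\<Union>D \<in> lmeasurable"
      using D(4) lmeasurable_division by blast
    have lD: "lD = measure lebesgue (\<Union>D)" unfolding lD_def by (rule measure_division_real[OF D(4), symmetric])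
    also have "\<dots> \<le> measure lebesgue G"
      using UD D(3) Gl by (intro measure_mono_fmeasurable) auto
    finally have "lD < \<eta>" using mG by simp
    moreover have "\<Union>D \<subseteq> {a..b}" using D(3) by (fastforce simp: G_def)
    ultimately have f1: "(\<Sum>K\<in>D. dist (f (Inf K)) (f (Sup K))) < 1" using \<eta>(2) D(4) by (simp add: lD_def)
    have "(2/e) * lD \<le> (\<Sum>K\<in>D. dist (f (Inf K)) (f (Sup K)))"
      unfolding lD_def sum_distrib_left
    proof (rule sum_mono)
      fix K assume "K \<in> D"
      then obtain u v where "u < v" "K = {u..v}" "f v - f u > (2/e) * (v - u)" using D(3) by blast
      then show "(2/e) * (Sup K - Inf K) \<le> dist (f (Inf K)) (f (Sup K))"
        by (simp add: dist_real_def)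
    qed
    then have "(2/e) * lD < 1" using f1 by simp
    then have "lD < e/2" using \<open>e > 0\<close> by (simp add: field_simps)
    moreover have "measure lebesgue (\<Union>D \<union> T) \<le> measure lebesgue (\<Union>D) + measure lebesgue T"
      using UD D by (intro measure_Un_le) auto
    ultimately have "measure lebesgue (\<Union>D \<union> T) \<le> e" using D(7) lD by simp
    then show "\<exists>T. S \<inter> G \<subseteq> T \<and> T \<in> lmeasurable \<and> measure lebesgue T \<le> e"
      using D UD by (intro exI[of _ "\<Union>D \<union> T"]) auto
  qed
  then show "\<exists>U. openin (top_of_set S) U \<and> x \<in> U \<and> negligible U"
    using \<open>x \<in> S\<close> S \<eta>(1) by (intro exI[of _ "S \<inter> G"]) (auto simp: openin_open G_def)
qed

lemma real_derivative_slope_cases: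
  fixes f :: "real \<Rightarrow> real" and x :: real
  defines "upp \<equiv> \<lambda>q. \<forall>d>0. \<exists>u v. u < v \<and> u \<le> x \<and> x \<le> v \<and> v - u < d \<and> f v - f u > q * (v - u)"
    and "low \<equiv> \<lambda>q. \<forall>d>0. \<exists>u v. u < v \<and> u \<le> x \<and> x \<le> v \<and> v - u < d \<and> f v - f u < q * (v - u)"
  shows "(\<exists>D. (f has_real_derivative D) (at x)) \<or> (\<forall>q. upp q) \<or> (\<forall>q. low q) \<or>
    (\<exists>p q. p < q \<and> low (real_of_rat p) \<and> upp (real_of_rat q))"
proof -
  define s where "s = (\<lambda>y. (f y - f x) / (y - x))"
  define l L where "l = Liminf (at x) (\<lambda>y. ereal (s y))" and "L = Limsup (at x) (\<lambda>y. ereal (s y))"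
  have A: "L \<le> ereal c" if "\<not> upp c" for c
  proof -
    obtain d where d: "d > 0" "\<And>u v. u < v \<Longrightarrow> u \<le> x \<Longrightarrow> x \<le> v \<Longrightarrow> v - u < d \<Longrightarrow> f v - f u \<le> c * (v - u)"
      using \<open>\<not> upp c\<close> unfolding upp_def by (meson not_le)
    have "s y \<le> c" if y: "y \<noteq> x" "dist y x < d" for y
    proof (cases "y < x")
      case True
      then have "f x - f y \<le> c * (x - y)" using d(2)[of y x] y by (simp add: dist_real_def)
      moreover have "s y = (f x - f y) / (x - y)" unfolding s_def by (metis minus_diff_eq minus_divide_divide)
      ultimately show ?thesis using True by (simp add: pos_divide_le_eq)
    next
      case False
      then have "f y - f x \<le> c * (y - x)" using d(2)[of x y] y by (simp add: dist_real_def)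
      then show ?thesis using False y by (simp add: s_def pos_divide_le_eq)
    qed
    then have "eventually (\<lambda>y. ereal (s y) \<le> ereal c) (at x)"
      unfolding eventually_at using d(1) by auto
    then show ?thesis unfolding L_def by (rule Limsup_bounded)
  qed
  have B: "ereal c \<le> l" if "\<not> low c" for c
  proof -
    obtain d where d: "d > 0" "\<And>u v. u < v \<Longrightarrow> u \<le> x \<Longrightarrow> x \<le> v \<Longrightarrow> v - u < d \<Longrightarrow> f v - f u \<ge> c * (v - u)"
      using \<open>\<not> low c\<close> unfolding low_def by (meson not_le)
    have "s y \<ge> c" if y: "y \<noteq> x" "dist y x < d" for y
    proof (cases "y < x")
      case True
      then have "f x - f y \<ge> c * (x - y)" using d(2)[of y x] y by (simp add: dist_real_def)
      moreover have "s y = (f x - f y) / (x - y)" unfolding s_def by (metis minus_diff_eq minus_divide_divide)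
      ultimately show ?thesis using True by (simp add: pos_le_divide_eq)
    next
      case False
      then have "f y - f x \<ge> c * (y - x)" using d(2)[of x y] y by (simp add: dist_real_def)
      then show ?thesis using False y by (simp add: s_def pos_le_divide_eq)
    qed
    then have "eventually (\<lambda>y. ereal c \<le> ereal (s y)) (at x)"
      unfolding eventually_at using d(1) by auto
    then show ?thesis unfolding l_def by (rule Liminf_bounded)
  qed
  have "l \<le> L" unfolding l_def L_def by (rule Liminf_le_Limsup) simp
  show ?thesis
  proof (cases "l < L")
    case True
    then obtain p where p: "l < ereal (real_of_rat p)" "ereal (real_of_rat p) < L" using ereal_dense3 by blast
    then obtain q where q: "ereal (real_of_rat p) < ereal (real_of_rat q)" "ereal (real_of_rat q) < L" using ereal_dense3 by blast
    have "low (real_of_rat p)" using B p(1) by (meson not_le)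
    moreover have "upp (real_of_rat q)" using A q(2) by (meson not_le)
    ultimately show ?thesis using q(1) by (auto simp: of_rat_less)
  next
    case False
    then have eq: "l = L" using \<open>l \<le> L\<close> by simp
    show ?thesis
    proof (cases L)
      case (real D)
      have "((\<lambda>y. ereal (s y)) \<longlongrightarrow> ereal D) (at x)"
        using eq real by (intro Liminf_eq_Limsup) (auto simp: l_def L_def)
      then have "(f has_real_derivative D) (at x)"
        by (simp add: s_def has_field_derivative_iff)
      then show ?thesis by blast
    next
      case PInf
      then have "upp q" for q using A[of q] by auto
      then show ?thesis by blast
    next
      case MInf
      then have "low q" for q using B[of q] eq by auto
      then show ?thesis by blast
    qed
  qed
qed

lemma abs_continuous_on_real_differentiable_ae:
  fixes f :: "real \<Rightarrow> real"
  assumes AC: "abs_continuous_on a b f"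
  shows "negligible {x \<in> {a..b}. \<nexists>D. (f has_real_derivative D) (at x)}"
proof -
  define upp where "upp g x q \<longleftrightarrow> (\<forall>d>0. \<exists>u v. u < v \<and> u \<le> x \<and> x \<le> v \<and> v - u < d \<and> g v - g u > q * (v - u))"
    for g :: "real \<Rightarrow> real" and x q :: real
  define low where "low x q \<longleftrightarrow> (\<forall>d>0. \<exists>u v. u < v \<and> u \<le> x \<and> x \<le> v \<and> v - u < d \<and> f v - f u < q * (v - u))"
    for x q :: real
  have low_upp: "upp (\<lambda>t. - f t) x (- q)" if "low x q" for x q
  proof -
    have "(- f v - - f u > - q * (v - u)) = (f v - f u < q * (v - u))" for u v
      by (subst mult_minus_left) linarith
    then show ?thesis using that by (simp only: low_def upp_def)
  qed
  define E where "E p q = {x \<in> {a<..<b}. low x (real_of_rat p) \<and> upp f x (real_of_rat q)}" for p q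
  define I J where "I = {x \<in> {a<..<b}. \<forall>q. upp f x q}" and "J = {x \<in> {a<..<b}. \<forall>q. low x q}"
  have E: "negligible (E p q)" if "p < q" for p q
  proof (rule negligible_two_slopes[OF AC, of "real_of_rat p" "real_of_rat q"])
    show "real_of_rat p < real_of_rat q" using that by (simp add: of_rat_less)
  qed (auto simp: E_def low_def upp_def)
  have I: "negligible I"
    by (rule negligible_infinite_slope[OF AC]) (auto simp: I_def upp_def)
  have AC': "abs_continuous_on a b (\<lambda>t. - f t)"
    by (rule abs_continuous_on_lipschitz[OF AC zero_le_one]) (simp add: dist_real_def)
  have J: "negligible J"
  proof (rule negligible_infinite_slope[OF AC'])
    fix x q d :: real assume "x \<in> J" "0 < d"
    then have "upp (\<lambda>t. - f t) x (- (- q))" by (intro low_upp) (auto simp: J_def)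
    then show "\<exists>u v. u < v \<and> u \<le> x \<and> x \<le> v \<and> v - u < d \<and> - f v - - f u > q * (v - u)"
      using \<open>0 < d\<close> unfolding upp_def by (simp only: minus_minus)
  qed (auto simp: J_def)
  have neg: "negligible ((\<Union>(p,q) \<in> {(p,q). p < q}. E p q) \<union> I \<union> J \<union> {a,b})"
    using E by (intro negligible_Un I J negligible_countable_Union) (auto simp: countable_finite)
  show ?thesis
  proof (rule negligible_subset[OF neg], intro subsetI, rule ccontr)
    fix x assume "x \<in> {x \<in> {a..b}. \<nexists>D. (f has_real_derivative D) (at x)}"
      and "x \<notin> (\<Union>(p,q) \<in> {(p,q). p < q}. E p q) \<union> I \<union> J \<union> {a,b}"
    then have x: "x \<in> {a..b}" "\<nexists>D. (f has_real_derivative D) (at x)"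
      "x \<notin> I" "x \<notin> J" "x \<noteq> a" "x \<noteq> b" "\<And>p q. p < q \<Longrightarrow> x \<notin> E p q" by auto
    then have ab: "x \<in> {a<..<b}" using x by auto
    show False
      using real_derivative_slope_cases[of f x] x ab unfolding I_def J_def E_def low_def[symmetric] upp_def[symmetric]
      by blast
  qed
qed

lemma abs_continuous_on_differentiable_ae:
  fixes f :: "real \<Rightarrow> 'a::euclidean_space"
  assumes AC: "abs_continuous_on a b f"
  shows "negligible {x \<in> {a..b}. \<not> f differentiable (at x)}"
proof -
  define N where "N i = {x \<in> {a..b}. \<nexists>D. ((\<lambda>t. f t \<bullet> i) has_real_derivative D) (at x)}" for i
  have "negligible (N i)" if "i \<in> Basis" for i
    unfolding N_def
  proof (rule abs_continuous_on_real_differentiable_ae, rule abs_continuous_on_lipschitz[OF AC zero_le_one])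
    fix s t :: real
    show "dist (f s \<bullet> i) (f t \<bullet> i) \<le> 1 * dist (f s) (f t)"
      using Basis_le_norm[OF that, of "f s - f t"] by (simp add: dist_norm inner_diff_left)
  qed
  then have neg: "negligible (\<Union>i\<in>Basis. N i)" by (intro negligible_Union) auto
  show ?thesis
  proof (rule negligible_subset[OF neg], intro subsetI, rule ccontr)
    fix x assume "x \<in> {x \<in> {a..b}. \<not> f differentiable (at x)}" "x \<notin> (\<Union>i\<in>Basis. N i)"
    then have x: "x \<in> {a..b}" "\<not> f differentiable (at x)" "x \<notin> (\<Union>i\<in>Basis. N i)" by auto
    then have "\<forall>i\<in>Basis. \<exists>D. ((\<lambda>t. f t \<bullet> i) has_real_derivative D) (at x)" by (auto simp: N_def)
    then obtain D where D: "\<And>i. i \<in> Basis \<Longrightarrow> ((\<lambda>t. f t \<bullet> i) has_real_derivative D i) (at x)" by metis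
    have "(f has_derivative (\<lambda>h. h *\<^sub>R (\<Sum>i\<in>Basis. D i *\<^sub>R i))) (at x)"
      unfolding has_derivative_componentwise_within[of f]
    proof
      fix i :: 'a assume "i \<in> Basis"
      then have "((\<lambda>t. f t \<bullet> i) has_derivative (\<lambda>h. h * D i)) (at x)"
        using D[of i] by (simp add: has_field_derivative_def mult_commute_abs)
      then show "((\<lambda>t. f t \<bullet> i) has_derivative (\<lambda>h. h *\<^sub>R (\<Sum>i\<in>Basis. D i *\<^sub>R i) \<bullet> i)) (at x)"
        using \<open>i \<in> Basis\<close> by (simp add: inner_sum_left inner_Basis if_distrib cong: if_cong)
    qed
    then show False using x(2) by (auto simp: differentiable_def)
  qed
qed

lemma has_integral_ge_increment:
  fixes \<phi> :: "real \<Rightarrow> real"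
  assumes AC: "abs_continuous_on a b \<phi>" and "a \<le> b" and N: "negligible N"
    and G: "(G has_integral L) {a..b}"
    and der: "\<And>t. t \<in> {a..b} - N \<Longrightarrow> \<exists>D. (\<phi> has_real_derivative D) (at t) \<and> D \<le> G t"
  shows "\<phi> b - \<phi> a \<le> L"
proof (rule field_le_epsilon)
  fix e0 :: real assume "e0 > 0"
  define e where "e = e0 / (2 + (b - a))"
  have "e > 0" using \<open>e0 > 0\<close> \<open>a \<le> b\<close> by (simp add: e_def)
  define G' where "G' t = (if t \<in> N then 0 else G t)" for t
  have G': "(G' has_integral L) {a..b}"
    by (rule has_integral_spike[OF N _ G]) (auto simp: G'_def)
  obtain \<gamma> where \<gamma>: "gauge \<gamma>"
    "\<And>p. p tagged_division_of {a..b} \<Longrightarrow> \<gamma> fine p \<Longrightarrow>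
       \<bar>(\<Sum>(x,K)\<in>p. measure lborel K * G' x) - L\<bar> < e"
  proof -
    have "\<exists>\<gamma>. gauge \<gamma> \<and> (\<forall>p. p tagged_division_of {a..b} \<and> \<gamma> fine p \<longrightarrow>
        norm ((\<Sum>(x,K)\<in>p. measure lborel K *\<^sub>R G' x) - L) < e)"
      using G'[unfolded has_integral_real, rule_format, OF \<open>e > 0\<close>] .
    then show thesis using that by (auto simp: real_scaleR_def)
  qed
  obtain \<eta> where \<eta>: "0 < \<eta>"
    "\<And>D. D division_of \<Union>D \<Longrightarrow> \<Union>D \<subseteq> {a..b} \<Longrightarrow> (\<Sum>K\<in>D. Sup K - Inf K) < \<eta> \<Longrightarrow>
       (\<Sum>K\<in>D. dist (\<phi> (Inf K)) (\<phi> (Sup K))) < e"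
    using abs_continuous_on_division[OF AC \<open>e > 0\<close>] by blast
  obtain V where V: "open V" "N \<subseteq> V" "V \<in> lmeasurable" "measure lebesgue V < \<eta>"
    using lmeasurable_outer_open_less[OF negligible_imp_measurable[OF N] \<eta>(1)] negligible_imp_measure0[OF N]
    by auto
  have "\<exists>d>0. t \<in> {a..b} - N \<longrightarrow> (\<forall>u v. u \<le> t \<and> t \<le> v \<and> t - u < d \<and> v - t < d \<longrightarrow> \<phi> v - \<phi> u \<le> (G t + e) * (v - u))"
    for t
  proof (cases "t \<in> {a..b} - N")
    case True
    then obtain D where D: "(\<phi> has_real_derivative D) (at t)" "D \<le> G t" using der by blast
    then obtain d where d: "d > 0" "\<And>y. \<bar>y - t\<bar> < d \<Longrightarrow> \<bar>\<phi> y - \<phi> t - D * (y - t)\<bar> \<le> e * \<bar>y - t\<bar>"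
      using \<open>e > 0\<close> unfolding has_field_derivative_def has_derivative_at_alt by (auto simp: dist_norm)
    have "\<phi> v - \<phi> u \<le> (G t + e) * (v - u)" if "u \<le> t" "t \<le> v" "t - u < d" "v - t < d" for u v
    proof -
      have "\<phi> v - \<phi> u \<le> (D + e) * (v - u)"
        using d(2)[of u] d(2)[of v] that by (simp add: algebra_simps abs_le_iff)
      also have "\<dots> \<le> (G t + e) * (v - u)" using D(2) that by (intro mult_right_mono) auto
      finally show ?thesis .
    qed
    then show ?thesis using d(1) by blast
  qed (auto intro: exI[of _ 1])
  then obtain \<delta> where \<delta>: "\<And>t. \<delta> t > 0" 
    "\<And>t u v. t \<in> {a..b} - N \<Longrightarrow> u \<le> t \<Longrightarrow> t \<le> v \<Longrightarrow> t - u < \<delta> t \<Longrightarrow> v - t < \<delta> t \<Longrightarrow> \<phi> v - \<phi> u \<le> (G t + e) * (v - u)"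
    by metis
  define \<gamma>2 where "\<gamma>2 t = (if t \<in> N then V else ball t (\<delta> t))" for t
  have "gauge \<gamma>2" using V \<delta>(1) by (auto simp: gauge_def \<gamma>2_def)
  then have "gauge (\<lambda>t. \<gamma> t \<inter> \<gamma>2 t)" using \<gamma>(1) by (rule gauge_Int[rotated])
  then obtain p where p: "p tagged_division_of {a..b}" "(\<lambda>t. \<gamma> t \<inter> \<gamma>2 t) fine p"
    using fine_division_exists_real by blast
  have p1: "\<gamma> fine p" and p2: "\<gamma>2 fine p" using p(2) by (auto simp: fine_def)
  note P = tagged_division_ofD[OF p(1)]
  define pN where "pN = {xK \<in> p. fst xK \<in> N}"
  have "pN \<subseteq> p" by (auto simp: pN_def)
  have "p tagged_partial_division_of {a..b}"
    using p(1) by (simp only: tagged_division_of_def)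
  with \<open>pN \<subseteq> p\<close> have "pN tagged_partial_division_of {a..b}"
    by (rule tagged_partial_division_subset[rotated])
  then have pNdiv: "pN tagged_division_of \<Union>(snd ` pN)"
    by (rule tagged_partial_division_of_Union_self)
  then have div: "snd ` pN division_of \<Union>(snd ` pN)" by (rule division_of_tagged_division)
  have sub: "\<Union>(snd ` pN) \<subseteq> {a..b}" 
  proof (clarsimp simp del: atLeastAtMost_iff)
    fix z x K assume "(x, K) \<in> pN" "z \<in> K"
    then show "z \<in> {a..b}" using P(3)[of x K] \<open>pN \<subseteq> p\<close> by blast
  qed
  have "\<Union>(snd ` pN) \<subseteq> V" 
  proof (clarsimp)
    fix z x K assume "(x, K) \<in> pN" "z \<in> K"
    then have "(x, K) \<in> p" "x \<in> N" by (auto simp: pN_def)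
    then have "K \<subseteq> V" using fineD[OF p2] by (fastforce simp: \<gamma>2_def)
    then show "z \<in> V" using \<open>z \<in> K\<close> by blast
  qed
  moreover have "\<Union>(snd ` pN) \<in> lmeasurable" using div lmeasurable_division by blast
  ultimately have "measure lebesgue (\<Union>(snd ` pN)) \<le> measure lebesgue V"
    using V by (intro measure_mono_fmeasurable) auto
  then have "(\<Sum>K\<in>snd ` pN. dist (\<phi> (Inf K)) (\<phi> (Sup K))) < e"
    using measure_division_real[OF div] V(4) by (intro \<eta>(2)[OF div sub]) auto
  also have "(\<Sum>K\<in>snd ` pN. dist (\<phi> (Inf K)) (\<phi> (Sup K))) = (\<Sum>(x,K)\<in>pN. if K = {} then 0 else dist (\<phi> (Inf K)) (\<phi> (Sup K)))"
  proof -
    have "(\<Sum>(x,K)\<in>pN. if K = {} then 0 else dist (\<phi> (Inf K)) (\<phi> (Sup K))) = (\<Sum>K\<in>snd ` pN. if K = {} then 0 else dist (\<phi> (Inf K)) (\<phi> (Sup K)))"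
      by (rule sum.over_tagged_division_lemma[OF pNdiv]) auto
    also have "\<dots> = (\<Sum>K\<in>snd ` pN. dist (\<phi> (Inf K)) (\<phi> (Sup K)))"
      using division_ofD(3)[OF div] by (intro sum.cong) auto
    finally show ?thesis by simp
  qed
  also have "\<dots> = (\<Sum>(x,K)\<in>p. if x \<in> N then dist (\<phi> (Inf K)) (\<phi> (Sup K)) else 0)"
    unfolding pN_def using P(1,2) by (intro sum.mono_neutral_cong_left) (auto split: prod.splits)
  finally have sN: "(\<Sum>(x,K)\<in>p. if x \<in> N then dist (\<phi> (Inf K)) (\<phi> (Sup K)) else 0) < e" .
  have "\<phi> b - \<phi> a = (\<Sum>(x,K)\<in>p. \<phi> (Sup K) - \<phi> (Inf K))"
    using additive_tagged_division_1[OF \<open>a \<le> b\<close> p(1), of \<phi>] by simp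
  also have "\<dots> \<le> (\<Sum>(x,K)\<in>p. measure lborel K * G' x + e * (Sup K - Inf K) + (if x \<in> N then dist (\<phi> (Inf K)) (\<phi> (Sup K)) else 0))"
  proof (rule sum_mono, clarify)
    fix x K assume xK: "(x, K) \<in> p"
    obtain u v where uv: "K = {u..v}" "u \<le> x" "x \<le> v" using P(2,4)[OF xK] by auto
    show "\<phi> (Sup K) - \<phi> (Inf K) \<le> measure lborel K * G' x + e * (Sup K - Inf K) + (if x \<in> N then dist (\<phi> (Inf K)) (\<phi> (Sup K)) else 0)"
    proof (cases "x \<in> N")
      case True
      have "0 \<le> e * (v - u)" using \<open>e > 0\<close> uv by simp
      then show ?thesis using True uv by (simp add: G'_def dist_real_def)
    next
      case False
      have "K \<subseteq> ball x (\<delta> x)" using fineD[OF p2 xK] False by (simp add: \<gamma>2_def)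
      then have "u \<in> ball x (\<delta> x)" "v \<in> ball x (\<delta> x)" using uv by (force simp del: mem_ball)+
      then have "x - u < \<delta> x" "v - x < \<delta> x" using uv by (auto simp: dist_real_def)
      moreover have "x \<in> {a..b} - N" using P(2,3)[OF xK] False by auto
      ultimately have "\<phi> v - \<phi> u \<le> (G x + e) * (v - u)" using \<delta>(2) uv by blast
      then show ?thesis using False uv by (simp add: G'_def algebra_simps)
    qed
  qed
  also have "\<dots> = (\<Sum>(x,K)\<in>p. measure lborel K * G' x) + e * (\<Sum>(x,K)\<in>p. Sup K - Inf K) + (\<Sum>(x,K)\<in>p. if x \<in> N then dist (\<phi> (Inf K)) (\<phi> (Sup K)) else 0)"
    unfolding sum_distrib_left sum.distrib[symmetric] by (intro sum.cong) auto
  also have "(\<Sum>(x,K)\<in>p. Sup K - Inf K) = b - a"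
    using additive_tagged_division_1[OF \<open>a \<le> b\<close> p(1), of "\<lambda>x. x"] by simp
  also have "(\<Sum>(x,K)\<in>p. measure lborel K * G' x) + e * (b - a) + (\<Sum>(x,K)\<in>p. if x \<in> N then dist (\<phi> (Inf K)) (\<phi> (Sup K)) else 0)
    \<le> L + e * (2 + (b - a))"
    using \<gamma>(2)[OF p(1) p1] sN by (simp add: algebra_simps abs_less_iff)
  also have "\<dots> = L + e0" using \<open>a \<le> b\<close> by (simp add: e_def)
  finally show "\<phi> b - \<phi> a \<le> L + e0" .
qed

section \<open>Bounds for the Kobayashi metric\<close>

lemma norm_smult_complex_vec: "norm (c *s (v::complex^'d)) = cmod c * norm v"
  by (simp add: norm_vec_def norm_mult L2_set_right_distrib)

lemma of_real_smult_complex_vec: "of_real s *s (v::complex^'d) = s *\<^sub>R v"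
  by (simp only: vec_eq_iff vector_smult_component vector_scaleR_component) (simp add: scaleR_conv_of_real)

lemma inner_smult_complex_vec: "(a::complex^'d) \<bullet> (w *s a) = Re w * (norm a)\<^sup>2"
proof -
  have "a $ i \<bullet> (w * a $ i) = Re w * (a $ i \<bullet> a $ i)" for i
    by (simp add: inner_complex_def algebra_simps)
  then show ?thesis
    unfolding power2_norm_eq_inner inner_vec_def
    by (simp only: vector_smult_component sum_distrib_left)
qed

lemma bdd_below_cmod: "bdd_below {cmod \<zeta> |\<zeta> f. P \<zeta> f}"
  by (rule bdd_belowI[of _ 0]) auto

lemma kobayashi_metric_le:
  assumes "disc_map \<Omega> f" "f 0 = x" "\<zeta> *s cvec_deriv f 0 = v"
  shows "kobayashi_metric \<Omega> x v \<le> cmod \<zeta>"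
  unfolding kobayashi_metric_def using assms by (intro cInf_lower bdd_below_cmod) blast

lemma kobayashi_metric_line_le:
  fixes p n :: "complex^'d"
  assumes hol: "\<phi> holomorphic_on ball 0 1"
    and into: "\<And>z. z \<in> ball 0 1 \<Longrightarrow> p + \<phi> z *s n \<in> \<Omega>" and "\<zeta> * deriv \<phi> 0 = c"
  shows "kobayashi_metric \<Omega> (p + \<phi> 0 *s n) (c *s n) \<le> cmod \<zeta>"
proof (rule kobayashi_metric_le[where f = "\<lambda>z. p + \<phi> z *s n"])
  show "disc_map \<Omega> (\<lambda>z. p + \<phi> z *s n)"
    unfolding disc_map_def using into by (auto intro!: holomorphic_intros hol)
  have "(\<phi> has_field_derivative deriv \<phi> 0) (at 0)"
    by (rule holomorphic_derivI[OF hol]) auto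
  then have "((\<lambda>z. p $ i + \<phi> z * n $ i) has_field_derivative deriv \<phi> 0 * n $ i) (at 0)" for i
    by (auto intro!: derivative_eq_intros)
  then have "cvec_deriv (\<lambda>z. p + \<phi> z *s n) 0 = deriv \<phi> 0 *s n"
    by (simp add: cvec_deriv_def vec_eq_iff DERIV_imp_deriv)
  then show "\<zeta> *s cvec_deriv (\<lambda>z. p + \<phi> z *s n) 0 = c *s n"
    using assms(3) by (simp add: vec_eq_iff flip: mult.assoc)
qed simp

lemma kobayashi_metric_ball_le:
  fixes x v :: "complex^'d"
  assumes "ball x m \<subseteq> \<Omega>" "0 < m"
  shows "kobayashi_metric \<Omega> x v \<le> norm v / m"
proof -
  define c where "c = m / (norm v)"
  define \<phi> where "\<phi> z = of_real c * z" for z :: complex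
  have "kobayashi_metric \<Omega> (x + \<phi> 0 *s v) (1 *s v) \<le> cmod (of_real (norm v / m))" if "v \<noteq> 0"
  proof (rule kobayashi_metric_line_le)
    show "\<phi> holomorphic_on ball 0 1" unfolding \<phi>_def by (intro holomorphic_intros)
    show "x + \<phi> z *s v \<in> \<Omega>" if "z \<in> ball 0 1" for z
    proof -
      have "norm (\<phi> z *s v) = m * cmod z"
        using \<open>v \<noteq> 0\<close> \<open>0 < m\<close> by (simp add: norm_smult_complex_vec \<phi>_def norm_mult c_def norm_divide)
      also have "\<dots> < m * 1" using that \<open>0 < m\<close> by (intro mult_strict_left_mono) auto
      finally show ?thesis using assms(1) by (auto simp: dist_norm)
    qed
    have "deriv \<phi> 0 = of_real c" unfolding \<phi>_def by simp
    then show "of_real (norm v / m) * deriv \<phi> 0 = 1" using that \<open>0 < m\<close> by (simp add: c_def)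
  qed
  moreover have "kobayashi_metric \<Omega> (x + 0 *s v) (0 *s v) \<le> cmod 0"
    using assms by (intro kobayashi_metric_line_le) auto
  ultimately show ?thesis
    using \<open>0 < m\<close> by (cases "v = 0") (auto simp: \<phi>_def norm_divide)
qed

lemma kobayashi_metric_set_nonempty:
  fixes x v :: "complex^'d"
  assumes "open \<Omega>" "x \<in> \<Omega>"
  shows "{cmod \<zeta> |\<zeta> f. disc_map \<Omega> f \<and> f 0 = x \<and> \<zeta> *s cvec_deriv f 0 = v} \<noteq> {}"
proof -
  obtain m where m: "m > 0" "ball x m \<subseteq> \<Omega>" using assms openE by blast
  define c where "c = m / (norm v + 1)"
  have c: "c > 0" using m(1) by (simp add: c_def add_nonneg_pos)
  define f where "f z = x + (of_real c * z) *s v" for z :: complex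
  have "f z \<in> \<Omega>" if "z \<in> ball 0 1" for z
  proof -
    have "norm ((of_real c * z) *s v) = (c * norm v) * cmod z"
      using c by (simp add: norm_smult_complex_vec norm_mult)
    also have "\<dots> \<le> (c * norm v) * 1" using that c by (intro mult_left_mono) auto
    also have "\<dots> < c * (norm v + 1)" using c by simp
    also have "\<dots> = m" using add_nonneg_pos[of "norm v" 1] by (simp add: c_def)
    finally show ?thesis using m(2) by (auto simp: f_def dist_norm)
  qed
  then have "disc_map \<Omega> f" unfolding disc_map_def by (auto simp: f_def intro!: holomorphic_intros)
  moreover have "(1 / of_real c) *s cvec_deriv f 0 = v"
  proof -
    have "((\<lambda>z. x $ i + of_real c * z * v $ i) has_field_derivative of_real c * v $ i) (at 0)" for i
      by (auto intro!: derivative_eq_intros)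
    then have "deriv (\<lambda>z. x $ i + of_real c * z * v $ i) 0 = of_real c * v $ i" for i
      by (rule DERIV_imp_deriv)
    then show ?thesis using c by (simp add: cvec_deriv_def f_def vec_eq_iff)
  qed
  moreover have "f 0 = x" by (simp add: f_def)
  ultimately show ?thesis by blast
qed

lemma kobayashi_metric_ge:
  fixes x v :: "complex^'d"
  assumes "open \<Omega>" "x \<in> \<Omega>"
    and "\<And>\<zeta> f. disc_map \<Omega> f \<Longrightarrow> f 0 = x \<Longrightarrow> \<zeta> *s cvec_deriv f 0 = v \<Longrightarrow> c \<le> cmod \<zeta>"
  shows "c \<le> kobayashi_metric \<Omega> x v"
  unfolding kobayashi_metric_def
  using assms(3) by (intro cInf_greatest kobayashi_metric_set_nonempty assms) auto

lemma kobayashi_metric_less_obtain: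
  fixes x v :: "complex^'d"
  assumes "open \<Omega>" "x \<in> \<Omega>" "kobayashi_metric \<Omega> x v < c"
  obtains \<zeta> f where "disc_map \<Omega> f" "f 0 = x" "\<zeta> *s cvec_deriv f 0 = v" "cmod \<zeta> < c"
  using cInf_lessD[OF kobayashi_metric_set_nonempty[OF assms(1,2)] assms(3)[unfolded kobayashi_metric_def]]
  by blast

lemma kobayashi_metric_nonneg:
  assumes "open \<Omega>" "x \<in> \<Omega>"
  shows "0 \<le> kobayashi_metric \<Omega> x v"
  by (rule kobayashi_metric_ge[OF assms]) simp

lemma kobayashi_metric_pos:
  fixes x v :: "complex^'d"
  assumes "open \<Omega>" "bounded \<Omega>" "x \<in> \<Omega>" "v \<noteq> 0"
  shows "0 < kobayashi_metric \<Omega> x v"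
proof -
  obtain R where R: "R > 0" "\<And>x. x \<in> \<Omega> \<Longrightarrow> norm x \<le> R" using assms(2) bounded_pos by blast
  obtain i where i: "v $ i \<noteq> 0" using assms(4) by (auto simp: vec_eq_iff)
  have "cmod (v $ i) / (2 * R) \<le> kobayashi_metric \<Omega> x v"
  proof (rule kobayashi_metric_ge[OF assms(1,3)])
    fix \<zeta> f assume f: "disc_map \<Omega> f" "f 0 = x" "\<zeta> *s cvec_deriv f 0 = v"
    have hol: "(\<lambda>z. f z $ i) holomorphic_on ball 0 1" and im: "\<And>z. z \<in> ball 0 1 \<Longrightarrow> f z \<in> \<Omega>"
      using f(1) by (auto simp: disc_map_def)
    have sub: "cball 0 (1/2) \<subseteq> ball (0::complex) 1" by auto
    have "cmod ((deriv ^^ 1) (\<lambda>z. f z $ i) 0) \<le> fact 1 * R / (1/2) ^ 1"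
    proof (rule Cauchy_inequality)
      show "(\<lambda>z. f z $ i) holomorphic_on ball 0 (1/2)"
        using hol by (rule holomorphic_on_subset) auto
      show "continuous_on (cball 0 (1/2)) (\<lambda>z. f z $ i)"
        using hol sub holomorphic_on_imp_continuous_on holomorphic_on_subset by blast
      fix z :: complex assume "cmod (0 - z) = 1/2"
      then have "z \<in> ball 0 1" by simp
      then have "norm (f z) \<le> R" using im R(2) by blast
      then show "cmod (f z $ i) \<le> R" using Finite_Cartesian_Product.norm_nth_le order_trans by blast
    qed simp
    then have d: "cmod (deriv (\<lambda>z. f z $ i) 0) \<le> 2 * R" by simp
    have "v $ i = \<zeta> * deriv (\<lambda>z. f z $ i) 0" using f(3) by (auto simp: cvec_deriv_def)
    then have "cmod (v $ i) \<le> cmod \<zeta> * (2 * R)" using d by (simp add: norm_mult mult_left_mono)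
    then show "cmod (v $ i) / (2 * R) \<le> cmod \<zeta>" using R(1) by (simp add: pos_divide_le_eq)
  qed
  moreover have "0 < cmod (v $ i) / (2 * R)" using i R(1) by simp
  ultimately show ?thesis by linarith
qed

lemma disc_map_rotate:
  assumes f: "disc_map \<Omega> f" "\<zeta> *s cvec_deriv f 0 = v" and "\<zeta> \<noteq> 0"
  obtains g where "disc_map \<Omega> g" "g 0 = f 0" "cvec_deriv g 0 = (1 / of_real (cmod \<zeta>)) *s v"
proof -
  define u where "u = \<zeta> / of_real (cmod \<zeta>)"
  have u: "cmod u = 1" using \<open>\<zeta> \<noteq> 0\<close> by (simp add: u_def norm_divide)
  define g where "g z = f (u * z)" for z
  have hol: "(\<lambda>z. f z $ i) holomorphic_on ball 0 1" for i using f(1) by (auto simp: disc_map_def)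
  have im: "(\<lambda>z. u * z) ` ball 0 1 \<subseteq> ball 0 1" using u by (auto simp: norm_mult)
  have "(\<lambda>z. g z $ i) holomorphic_on ball 0 1" for i
    using holomorphic_on_compose_gen[OF _ hol im, of i] 
    by (simp add: g_def o_def holomorphic_intros)
  moreover have "g ` ball 0 1 \<subseteq> \<Omega>" using f(1) im unfolding g_def disc_map_def by fastforce
  ultimately have "disc_map \<Omega> g" by (simp add: disc_map_def)
  moreover have "deriv (\<lambda>z. f (u * z) $ i) 0 = u * deriv (\<lambda>z. f z $ i) 0" for i
  proof -
    have "((\<lambda>z. f z $ i) has_field_derivative deriv (\<lambda>z. f z $ i) 0) (at (u * 0))"
      using hol[of i] by (simp add: holomorphic_derivI)
    then have "((\<lambda>z. f (u * z) $ i) has_field_derivative deriv (\<lambda>z. f z $ i) 0 * u) (at 0)"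
      by (rule DERIV_chain2) (auto intro!: derivative_eq_intros)
    then show ?thesis by (simp add: DERIV_imp_deriv mult.commute)
  qed
  then have "cvec_deriv g 0 = u *s cvec_deriv f 0"
    by (simp add: cvec_deriv_def g_def vec_eq_iff)
  then have "cvec_deriv g 0 = (1 / of_real (cmod \<zeta>)) *s v"
    using f(2) by (auto simp: u_def)
  ultimately show thesis using that[of g] by (simp add: g_def)
qed

text \<open>
  Convex combinations of discs are discs, and the derivatives average once the discs are rotated so
  that \<open>f'(0)\<close> is a positive multiple of \<open>v\<close>. The resulting concavity yields continuity of the metric
  for fixed \<open>v\<close>, hence integrability along polygonal curves.
\<close>

lemma inverse_kobayashi_metric_concave:
  fixes v :: "complex^'d"
  assumes \<Omega>: "open \<Omega>" "bounded \<Omega>" "convex \<Omega>" and "v \<noteq> 0"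
  shows "convex_on \<Omega> (\<lambda>x. - (1 / kobayashi_metric \<Omega> x v))"
proof (rule convex_onI)
  fix t :: real and x y assume t: "0 < t" "t < 1" and xy: "x \<in> \<Omega>" "y \<in> \<Omega>"
  let ?w = "(1 - t) *\<^sub>R x + t *\<^sub>R y"
  define k where "k x = kobayashi_metric \<Omega> x v" for x
  have w: "?w \<in> \<Omega>" using convexD[OF \<Omega>(3) xy, of "1-t" t] t by simp
  have pos: "k x > 0" if "x \<in> \<Omega>" for x unfolding k_def using that assms by (intro kobayashi_metric_pos) auto
  have main: "(1 - t) / a + t / b \<le> 1 / k ?w" if a: "k x < a" and b: "k y < b" for a b
  proof -
    obtain \<zeta> f0 where f0: "disc_map \<Omega> f0" "f0 0 = x" "\<zeta> *s cvec_deriv f0 0 = v" "cmod \<zeta> < a"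
      using kobayashi_metric_less_obtain[OF \<Omega>(1) xy(1) a[unfolded k_def]] by blast
    obtain \<omega> g0 where g0: "disc_map \<Omega> g0" "g0 0 = y" "\<omega> *s cvec_deriv g0 0 = v" "cmod \<omega> < b"
      using kobayashi_metric_less_obtain[OF \<Omega>(1) xy(2) b[unfolded k_def]] by blast
    have nz: "\<zeta> \<noteq> 0" "\<omega> \<noteq> 0" using f0(3) g0(3) \<open>v \<noteq> 0\<close> by auto
    obtain f where f: "disc_map \<Omega> f" "f 0 = x" "cvec_deriv f 0 = (1 / of_real (cmod \<zeta>)) *s v"
      using disc_map_rotate[OF f0(1,3) nz(1)] f0(2) by metis
    obtain g where g: "disc_map \<Omega> g" "g 0 = y" "cvec_deriv g 0 = (1 / of_real (cmod \<omega>)) *s v"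
      using disc_map_rotate[OF g0(1,3) nz(2)] g0(2) by metis
    define h where "h z = (1 - t) *\<^sub>R f z + t *\<^sub>R g z" for z
    define \<mu> where "\<mu> = (1 - t) / cmod \<zeta> + t / cmod \<omega>"
    have \<mu>: "\<mu> > 0" using t nz by (simp add: \<mu>_def add_pos_pos)
    have holf: "(\<lambda>z. f z $ i) holomorphic_on ball 0 1" and holg: "(\<lambda>z. g z $ i) holomorphic_on ball 0 1" for i
      using f(1) g(1) by (auto simp: disc_map_def)
    have "h z \<in> \<Omega>" if "z \<in> ball 0 1" for z
      using that f(1) g(1) t unfolding h_def disc_map_def by (intro convexD[OF \<Omega>(3)]) auto
    then have "disc_map \<Omega> h"
      unfolding disc_map_def using holf holg by (auto simp: h_def scaleR_conv_of_real intro!: holomorphic_intros)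
    moreover have "h 0 = ?w" by (simp add: h_def f g)
    moreover have "cvec_deriv h 0 = of_real \<mu> *s v"
    proof -
      have "deriv (\<lambda>z. h z $ i) 0 = of_real (1 - t) * cvec_deriv f 0 $ i + of_real t * cvec_deriv g 0 $ i" for i
      proof (rule DERIV_imp_deriv)
        have df: "((\<lambda>z. f z $ i) has_field_derivative cvec_deriv f 0 $ i) (at 0)"
          unfolding cvec_deriv_def vec_lambda_beta by (rule holomorphic_derivI[OF holf]) auto
        have dg: "((\<lambda>z. g z $ i) has_field_derivative cvec_deriv g 0 $ i) (at 0)"
          unfolding cvec_deriv_def vec_lambda_beta by (rule holomorphic_derivI[OF holg]) auto
        have "((\<lambda>z. of_real (1 - t) * f z $ i + of_real t * g z $ i) has_field_derivative
            of_real (1 - t) * cvec_deriv f 0 $ i + of_real t * cvec_deriv g 0 $ i) (at 0)"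
          by (intro DERIV_add DERIV_cmult df dg)
        moreover have "h z $ i = of_real (1 - t) * f z $ i + of_real t * g z $ i" for z
          unfolding h_def vector_add_component vector_scaleR_component by (simp only: scaleR_conv_of_real)
        ultimately show "((\<lambda>z. h z $ i) has_field_derivative
            of_real (1 - t) * cvec_deriv f 0 $ i + of_real t * cvec_deriv g 0 $ i) (at 0)"
          by (simp only:)
      qed
      then show ?thesis
        by (simp add: cvec_deriv_def[of h] vec_eq_iff f(3) g(3) \<mu>_def field_simps)
    qed
    ultimately have "k ?w \<le> cmod (1 / of_real \<mu>)"
      unfolding k_def using \<mu> by (intro kobayashi_metric_le[of \<Omega> h]) auto
    then have "k ?w \<le> 1 / \<mu>" using \<mu> by (simp add: norm_divide)
    then have "\<mu> \<le> 1 / k ?w" using \<mu> pos[OF w] by (simp add: field_simps)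
    moreover have "(1 - t) / a \<le> (1 - t) / cmod \<zeta>" "t / b \<le> t / cmod \<omega>"
      using t nz f0(4) g0(4) by (auto intro!: frac_le)
    ultimately show ?thesis by (simp add: \<mu>_def)
  qed
  have "(1 - t) / k x + t / k y \<le> 1 / k ?w"
  proof (rule field_le_mult_one_interval)
    fix z :: real assume z: "0 < z" "z < 1"
    have "k x < k x / z" "k y < k y / z" using z pos xy by (simp_all add: field_simps)
    from main[OF this] show "z * ((1 - t) / k x + t / k y) \<le> 1 / k ?w" by (simp add: algebra_simps)
  qed
  then show "- (1 / kobayashi_metric \<Omega> ?w v) \<le> (1 - t) * - (1 / kobayashi_metric \<Omega> x v) + t * - (1 / kobayashi_metric \<Omega> y v)"
    by (simp add: k_def)
qed (rule \<Omega>)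

lemma continuous_on_kobayashi_metric:
  fixes v :: "complex^'d"
  assumes \<Omega>: "open \<Omega>" "bounded \<Omega>" "convex \<Omega>"
  shows "continuous_on \<Omega> (\<lambda>x. kobayashi_metric \<Omega> x v)"
proof (cases "v = 0")
  case True
  have "kobayashi_metric \<Omega> x v = 0" if x: "x \<in> \<Omega>" for x
  proof -
    obtain m where m: "m > 0" "ball x m \<subseteq> \<Omega>" using \<Omega>(1) x openE by blast
    show ?thesis
      using kobayashi_metric_ball_le[OF m(2,1), of v] kobayashi_metric_nonneg[OF \<Omega>(1) x, of v] True by simp
  qed
  then show ?thesis by (simp cong: continuous_on_cong)
next
  case False
  define g where "g x = - (1 / kobayashi_metric \<Omega> x v)" for x
  have "continuous_on \<Omega> g"
    unfolding g_def by (rule convex_on_continuous[OF \<Omega>(1) inverse_kobayashi_metric_concave[OF \<Omega> False]])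
  moreover have nz: "kobayashi_metric \<Omega> x v \<noteq> 0" if "x \<in> \<Omega>" for x
    using kobayashi_metric_pos[OF \<Omega>(1,2) that False] by simp
  ultimately have "continuous_on \<Omega> (\<lambda>x. 1 / - g x)"
    by (intro continuous_on_divide continuous_on_const continuous_on_minus) (auto simp: g_def)
  then show ?thesis by (simp add: g_def)
qed

lemma Schwarz_half_plane:
  assumes hol: "G holomorphic_on ball 0 1" and pos: "\<And>z. z \<in> ball 0 1 \<Longrightarrow> 0 < Re (G z)"
  shows "cmod (deriv G 0) \<le> 2 * Re (G 0)"
proof -
  define a where "a = G 0"
  have a: "Re a > 0" using pos[of 0] by (simp add: a_def)
  define F where "F z = (G z - a) / (G z + cnj a)" for z
  have nz: "G z + cnj a \<noteq> 0" if "z \<in> ball 0 1" for z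
  proof
    assume "G z + cnj a = 0"
    then have "Re (G z) + Re a = 0" by (metis complex_cnj(1) plus_complex.simps(1) zero_complex.simps(1) complex_cnj_cnj cnj.simps(1))
    then show False using pos[OF that] a by simp
  qed
  have holF: "F holomorphic_on ball 0 1"
    unfolding F_def using nz by (intro holomorphic_intros hol) auto
  have "cmod (F z) < 1" if "cmod z < 1" for z
  proof -
    have z: "z \<in> ball 0 1" using that by simp
    have "(cmod (G z - a))\<^sup>2 < (cmod (G z + cnj a))\<^sup>2"
      using mult_pos_pos[OF pos[OF z] a] unfolding cmod_power2 by (simp add: power2_eq_square algebra_simps)
    then have "cmod (G z - a) < cmod (G z + cnj a)" using power2_less_imp_less norm_ge_zero by blast
    then show ?thesis using nz[OF z] by (simp add: F_def norm_divide)
  qed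
  then have "cmod (deriv F 0) \<le> 1"
    using Schwarz_Lemma(2)[OF holF, of 0] by (simp add: F_def a_def)
  moreover have "deriv F 0 = deriv G 0 / (2 * of_real (Re a))"
  proof (rule DERIV_imp_deriv)
    have dG: "(G has_field_derivative deriv G 0) (at 0)" by (rule holomorphic_derivI[OF hol]) auto
    have ne: "a + cnj a \<noteq> 0" using nz[of 0] by (simp add: a_def)
    have "(F has_field_derivative (deriv G 0 * (G 0 + cnj a) - (G 0 - a) * deriv G 0) / ((G 0 + cnj a) * (G 0 + cnj a))) (at 0)"
      unfolding F_def using ne by (auto intro!: derivative_eq_intros dG simp: a_def)
    then show "(F has_field_derivative deriv G 0 / (2 * of_real (Re a))) (at 0)"
      using ne by (simp add: a_def[symmetric] complex_add_cnj)
  qed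
  ultimately show ?thesis using a by (simp add: norm_divide norm_mult field_simps flip: a_def)
qed

lemma kobayashi_metric_ge_halfspace:
  fixes a x v :: "complex^'d"
  assumes "open \<Omega>" "x \<in> \<Omega>" and lt: "\<And>y. y \<in> \<Omega> \<Longrightarrow> a \<bullet> y < c"
  shows "\<bar>a \<bullet> v\<bar> / (2 * (c - a \<bullet> x)) \<le> kobayashi_metric \<Omega> x v"
proof (rule kobayashi_metric_ge[OF assms(1,2)])
  fix \<zeta> f assume f: "disc_map \<Omega> f" "f 0 = x" "\<zeta> *s cvec_deriv f 0 = v"
  define H where "H y = (\<Sum>i\<in>UNIV. cnj (a $ i) * y $ i)" for y :: "complex^'d"
  have ReH: "Re (H y) = a \<bullet> y" for y
    by (simp add: H_def inner_vec_def inner_complex_def)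
  have hol: "(\<lambda>z. f z $ i) holomorphic_on ball 0 1" for i using f(1) by (auto simp: disc_map_def)
  define G where "G z = of_real c - H (f z)" for z
  have holG: "G holomorphic_on ball 0 1" unfolding G_def H_def by (intro holomorphic_intros hol)
  have "cmod (deriv G 0) \<le> 2 * Re (G 0)"
  proof (rule Schwarz_half_plane[OF holG])
    show "0 < Re (G z)" if "z \<in> ball 0 1" for z
    proof -
      have "f z \<in> \<Omega>" using f(1) that unfolding disc_map_def by blast
      then show ?thesis using lt[of "f z"] by (simp add: G_def ReH)
    qed
  qed
  moreover have "Re (G 0) = c - a \<bullet> x" by (simp add: G_def ReH f(2))
  moreover have "deriv G 0 = - H (cvec_deriv f 0)"
  proof (rule DERIV_imp_deriv)
    have df: "((\<lambda>z. f z $ i) has_field_derivative cvec_deriv f 0 $ i) (at 0)" for i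
      unfolding cvec_deriv_def vec_lambda_beta by (rule holomorphic_derivI[OF hol]) auto
    show "(G has_field_derivative - H (cvec_deriv f 0)) (at 0)"
      unfolding G_def H_def by (auto intro!: derivative_eq_intros df simp: mult.commute)
  qed
  moreover have "H v = \<zeta> * H (cvec_deriv f 0)"
    unfolding f(3)[symmetric] by (simp add: H_def sum_distrib_left algebra_simps)
  ultimately have "cmod (H v) \<le> cmod \<zeta> * (2 * (c - a \<bullet> x))"
    by (simp add: norm_mult mult_left_mono)
  then have "\<bar>a \<bullet> v\<bar> \<le> cmod \<zeta> * (2 * (c - a \<bullet> x))"
    using abs_Re_le_cmod[of "H v"] by (simp add: ReH)
  then show "\<bar>a \<bullet> v\<bar> / (2 * (c - a \<bullet> x)) \<le> cmod \<zeta>"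
    using lt[OF assms(2)] by (simp add: pos_divide_le_eq)
qed

lemma kobayashi_metric_cone_le:
  fixes p n :: "complex^'d"
  assumes r: "0 < r" "r < 1" and "0 < s"
    and cone: "\<And>w. (1 - r) / (1 + r) \<le> Re w \<Longrightarrow> cmod w \<le> (1 + r) / (1 - r) \<Longrightarrow> p + (of_real s * w) *s n \<in> \<Omega>"
  shows "kobayashi_metric \<Omega> (p + of_real s *s n) n \<le> 1 / (2 * r * s)"
proof -
  define \<phi> where "\<phi> z = of_real s * ((1 + of_real r * z) / (1 - of_real r * z))" for z :: complex
  have bd: "r * cmod z \<le> r" if "z \<in> ball 0 1" for z :: complex using that r by (simp add: mult_left_le)
  have nz: "1 - of_real r * z \<noteq> 0" if "z \<in> ball 0 1" for z :: complex
  proof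
    assume "1 - of_real r * z = 0"
    then have "of_real r * z = 1" by simp
    then have "r * cmod z = 1" using r by (metis norm_mult norm_of_real norm_one abs_of_pos)
    then show False using bd[OF that] r by simp
  qed
  have "kobayashi_metric \<Omega> (p + \<phi> 0 *s n) (1 *s n) \<le> cmod (of_real (1 / (2 * r * s)))"
  proof (rule kobayashi_metric_line_le)
    show "\<phi> holomorphic_on ball 0 1" unfolding \<phi>_def using nz by (intro holomorphic_intros) auto
    show "p + \<phi> z *s n \<in> \<Omega>" if z: "z \<in> ball 0 1" for z :: complex
      unfolding \<phi>_def
    proof (rule cone)
      define u where "u = of_real r * z"
      have u: "cmod u \<le> r" using bd[OF z] r by (simp add: u_def norm_mult)
      have "1 - r \<le> cmod (1 - u)" using norm_triangle_ineq2[of 1 u] u by simp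
      moreover have "cmod (1 + u) \<le> 1 + r" using norm_triangle_ineq[of 1 u] u by simp
      ultimately show "cmod ((1 + of_real r * z) / (1 - of_real r * z)) \<le> (1 + r) / (1 - r)"
        unfolding u_def[symmetric] norm_divide using r by (intro frac_le) auto
      have ne: "1 - u \<noteq> 0" using nz[OF z] by (simp add: u_def)
      have "Re ((1 + u) / (1 - u)) = (1 - (cmod u)\<^sup>2) / (cmod (1 - u))\<^sup>2"
        unfolding cmod_power2 by (simp add: Re_divide power2_eq_square algebra_simps)
      also have "\<dots> \<ge> (1 - r\<^sup>2) / (1 + r)\<^sup>2"
      proof (rule frac_le)
        show "1 - r\<^sup>2 \<le> 1 - (cmod u)\<^sup>2" using u by (simp add: power_mono)
        show "0 \<le> 1 - (cmod u)\<^sup>2" using u r by (simp add: power_le_one)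
        show "0 < (cmod (1 - u))\<^sup>2" using ne by simp
        have "cmod (1 - u) \<le> 1 + r" using norm_triangle_ineq4[of 1 u] u by simp
        then show "(cmod (1 - u))\<^sup>2 \<le> (1 + r)\<^sup>2" by (simp add: power_mono)
      qed
      also have "(1 - r\<^sup>2) / (1 + r)\<^sup>2 = (1 - r) / (1 + r)"
        using r by (simp add: power2_eq_square divide_simps) (simp add: algebra_simps)
      finally show "(1 - r) / (1 + r) \<le> Re ((1 + of_real r * z) / (1 - of_real r * z))"
        by (simp add: u_def)
    qed
    have "(\<phi> has_field_derivative of_real (2 * r * s)) (at 0)"
      unfolding \<phi>_def by (auto intro!: derivative_eq_intros)
    then have "deriv \<phi> 0 = of_real (2 * r * s)" by (rule DERIV_imp_deriv)
    then show "of_real (1 / (2 * r * s)) * deriv \<phi> 0 = 1" using r \<open>0 < s\<close> by (simp flip: of_real_mult)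
  qed
  then show ?thesis using r \<open>0 < s\<close> by (simp add: \<phi>_def norm_divide norm_mult)
qed

section \<open>Lengths of curves\<close>

lemma abs_continuous_on_ident: "abs_continuous_on a b (\<lambda>t. t)"
  unfolding abs_continuous_on_def
proof (intro allI impI)
  fix e :: real assume e: "0 < e"
  show "\<exists>\<eta>>0. \<forall>(n::nat) l u.
        (\<forall>i<n. a \<le> l i \<and> l i \<le> u i \<and> u i \<le> b) \<and>
        disjoint_family_on (\<lambda>i. {l i<..<u i}) {..<n} \<and>
        (\<Sum>i<n. u i - l i) < \<eta> \<longrightarrow> (\<Sum>i<n. dist (l i) (u i)) < e"
  proof (intro exI[of _ e] conjI allI impI e)
    fix n :: nat and l u :: "nat \<Rightarrow> real"
    assume H: "(\<forall>i<n. a \<le> l i \<and> l i \<le> u i \<and> u i \<le> b) \<and>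
        disjoint_family_on (\<lambda>i. {l i<..<u i}) {..<n} \<and> (\<Sum>i<n. u i - l i) < e"
    then have "(\<Sum>i<n. dist (l i) (u i)) = (\<Sum>i<n. u i - l i)"
      by (intro sum.cong) (auto simp: dist_real_def)
    then show "(\<Sum>i<n. dist (l i) (u i)) < e" using H by simp
  qed
qed

lemma abs_continuous_on_imp_continuous_on:
  assumes "abs_continuous_on a b f"
  shows "continuous_on {a..b} f"
  unfolding continuous_on_iff
proof (intro ballI allI impI)
  fix x e :: real assume x: "x \<in> {a..b}" and "0 < e"
  then obtain \<eta> where \<eta>: "\<eta> > 0" "\<And>(n::nat) l u.
        (\<forall>i<n. a \<le> l i \<and> l i \<le> u i \<and> u i \<le> b) \<and>
        disjoint_family_on (\<lambda>i. {l i<..<u i}) {..<n} \<and>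
        (\<Sum>i<n. u i - l i) < \<eta> \<Longrightarrow> (\<Sum>i<n. dist (f (l i)) (f (u i))) < e"
    using assms unfolding abs_continuous_on_def by blast
  have "dist (f y) (f x) < e" if y: "y \<in> {a..b}" "dist y x < \<eta>" for y
  proof (cases "x \<le> y")
    case True
    then show ?thesis using \<eta>(2)[of 1 "\<lambda>_. x" "\<lambda>_. y"] x y
      by (simp add: disjoint_family_on_def dist_real_def dist_commute)
  next
    case False
    then show ?thesis using \<eta>(2)[of 1 "\<lambda>_. y" "\<lambda>_. x"] x y
      by (simp add: disjoint_family_on_def dist_real_def)
  qed
  then show "\<exists>d>0. \<forall>y\<in>{a..b}. dist y x < d \<longrightarrow> dist (f y) (f x) < e"
    using \<eta>(1) by blast
qed

lemma convex_segment_mem: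
  fixes x v :: "'a::real_vector"
  assumes "convex \<Omega>" "x \<in> \<Omega>" "x + v \<in> \<Omega>" "0 \<le> t" "t \<le> 1"
  shows "x + t *\<^sub>R v \<in> \<Omega>"
proof -
  have "(1 - t) *\<^sub>R x + t *\<^sub>R (x + v) \<in> \<Omega>" using assms by (intro convexD) auto
  then show ?thesis by (simp add: algebra_simps)
qed

definition kobayashi_lengths :: "(complex^'d) set \<Rightarrow> complex^'d \<Rightarrow> complex^'d \<Rightarrow> real set" where
  "kobayashi_lengths \<Omega> x y = {L. \<exists>\<sigma> a b. a \<le> b \<and> abs_continuous_on a b \<sigma> \<and> \<sigma> ` {a..b} \<subseteq> \<Omega> \<and> \<sigma> a = x \<and> \<sigma> b = y \<and>
     ((\<lambda>t. kobayashi_metric \<Omega> (\<sigma> t) (vector_derivative \<sigma> (at t))) has_integral L) {a..b}}"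

lemma kobayashi_dist_le:
  assumes "open \<Omega>" and L: "L \<in> kobayashi_lengths \<Omega> x y"
  shows "kobayashi_dist \<Omega> x y \<le> L"
  unfolding kobayashi_dist_def kobayashi_lengths_def[symmetric]
proof (rule cInf_lower[OF L])
  have "0 \<le> L" if "L \<in> kobayashi_lengths \<Omega> x y" for L
  proof -
    obtain \<sigma> :: "real \<Rightarrow> complex^'a" and a b where \<sigma>: "\<sigma> ` {a..b} \<subseteq> \<Omega>"
      "((\<lambda>t. kobayashi_metric \<Omega> (\<sigma> t) (vector_derivative \<sigma> (at t))) has_integral L) {a..b}"
      using \<open>L \<in> kobayashi_lengths \<Omega> x y\<close> by (auto simp: kobayashi_lengths_def)
    show ?thesis
      using \<sigma>(1) by (intro has_integral_nonneg[OF \<sigma>(2)] kobayashi_metric_nonneg assms(1)) auto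
  qed
  then show "bdd_below (kobayashi_lengths \<Omega> x y)" by (meson bdd_belowI)
qed

lemma kobayashi_length_two_segments:
  fixes q n w :: "complex^'d"
  assumes \<Omega>: "open \<Omega>" "bounded \<Omega>" "convex \<Omega>" and "0 \<le> T"
    and q: "q \<in> \<Omega>" "q + T *\<^sub>R n \<in> \<Omega>" "q + T *\<^sub>R n + w \<in> \<Omega>"
    and g: "\<And>t. 0 \<le> t \<Longrightarrow> t \<le> T \<Longrightarrow> kobayashi_metric \<Omega> (q + t *\<^sub>R n) n \<le> g t" "(g has_integral A) {0..T}"
    and B: "\<And>t. 0 \<le> t \<Longrightarrow> t \<le> 1 \<Longrightarrow> kobayashi_metric \<Omega> (q + T *\<^sub>R n + t *\<^sub>R w) w \<le> B"
  shows "\<exists>L \<in> kobayashi_lengths \<Omega> q (q + T *\<^sub>R n + w). L \<le> A + B"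
proof -
  define \<sigma> where "\<sigma> t = q + min t T *\<^sub>R n + max (t - T) 0 *\<^sub>R w" for t
  let ?k = "kobayashi_metric \<Omega>"
  have seg1: "q + t *\<^sub>R n \<in> \<Omega>" if "0 \<le> t" "t \<le> T" for t
  proof (cases "T = 0")
    case False
    then have "q + (t / T) *\<^sub>R (T *\<^sub>R n) \<in> \<Omega>"
      using that by (intro convex_segment_mem \<Omega> q) auto
    then show ?thesis using False by simp
  qed (use that q in auto)
  have seg2: "q + T *\<^sub>R n + (t - T) *\<^sub>R w \<in> \<Omega>" if "T \<le> t" "t \<le> T + 1" for t
    using that by (intro convex_segment_mem \<Omega> q) auto
  have AC: "abs_continuous_on 0 (T + 1) \<sigma>"
  proof (rule abs_continuous_on_lipschitz[OF abs_continuous_on_ident, where C = "norm n + norm w"])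
    fix s t :: real
    have "\<sigma> s - \<sigma> t = (min s T - min t T) *\<^sub>R n + (max (s - T) 0 - max (t - T) 0) *\<^sub>R w"
      by (simp add: \<sigma>_def algebra_simps)
    then have "dist (\<sigma> s) (\<sigma> t) \<le> \<bar>min s T - min t T\<bar> * norm n + \<bar>max (s - T) 0 - max (t - T) 0\<bar> * norm w"
      unfolding dist_norm by (metis norm_triangle_ineq norm_scaleR)
    also have "\<dots> \<le> \<bar>s - t\<bar> * norm n + \<bar>s - t\<bar> * norm w"
      by (intro add_mono mult_right_mono) (auto simp: min_def max_def)
    finally show "dist (\<sigma> s) (\<sigma> t) \<le> (norm n + norm w) * dist s t"
      by (simp add: dist_real_def algebra_simps)
  qed auto
  have im: "\<sigma> ` {0..T + 1} \<subseteq> \<Omega>"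
  proof clarify
    fix t assume t: "t \<in> {0..T + 1}"
    show "\<sigma> t \<in> \<Omega>"
    proof (cases "t \<le> T")
      case True then show ?thesis using seg1[of t] t by (simp add: \<sigma>_def min_def max_def)
    next
      case False then show ?thesis using seg2[of t] t by (simp add: \<sigma>_def min_def max_def)
    qed
  qed
  have vd1: "vector_derivative \<sigma> (at t) = n" if "t < T" for t
  proof (rule vector_derivative_at)
    have "((\<lambda>t. q + t *\<^sub>R n) has_vector_derivative n) (at t)" by (auto intro!: derivative_eq_intros)
    then show "(\<sigma> has_vector_derivative n) (at t)"
      by (rule has_vector_derivative_transform_within_open[where S = "{..<T}"]) (use that in \<open>auto simp: \<sigma>_def\<close>)
  qed
  have vd2: "vector_derivative \<sigma> (at t) = w" if "T < t" for t
  proof (rule vector_derivative_at)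
    have "((\<lambda>t. q + T *\<^sub>R n + (t - T) *\<^sub>R w) has_vector_derivative w) (at t)" by (auto intro!: derivative_eq_intros)
    then show "(\<sigma> has_vector_derivative w) (at t)"
      by (rule has_vector_derivative_transform_within_open[where S = "{T<..}"]) (use that in \<open>auto simp: \<sigma>_def\<close>)
  qed
  have "continuous_on {0..T} (\<lambda>t. ?k (q + t *\<^sub>R n) n)"
    by (rule continuous_on_compose2[OF continuous_on_kobayashi_metric[OF \<Omega>, of n]])
      (use seg1 in \<open>auto intro!: continuous_intros\<close>)
  then obtain I1 where I1: "((\<lambda>t. ?k (q + t *\<^sub>R n) n) has_integral I1) {0..T}"
    using integrable_continuous_interval integrable_on_def by metis
  have "I1 \<le> A" by (rule has_integral_le[OF I1 g(2)]) (use g(1) in auto)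
  have J1: "((\<lambda>t. ?k (\<sigma> t) (vector_derivative \<sigma> (at t))) has_integral I1) {0..T}"
    by (rule has_integral_spike[OF negligible_sing[of T] _ I1]) (auto simp: vd1 \<sigma>_def)
  have "continuous_on {T..T + 1} (\<lambda>t. ?k (q + T *\<^sub>R n + (t - T) *\<^sub>R w) w)"
    by (rule continuous_on_compose2[OF continuous_on_kobayashi_metric[OF \<Omega>, of w]])
      (use seg2 in \<open>auto intro!: continuous_intros\<close>)
  then obtain I2 where I2: "((\<lambda>t. ?k (q + T *\<^sub>R n + (t - T) *\<^sub>R w) w) has_integral I2) {T..T + 1}"
    using integrable_continuous_interval integrable_on_def by metis
  have "((\<lambda>t. B) has_integral B) {T..T + 1}" using has_integral_const_real[of B T "T + 1"] by simp
  then have "I2 \<le> B" by (rule has_integral_le[OF I2]) (use B in auto)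
  have J2: "((\<lambda>t. ?k (\<sigma> t) (vector_derivative \<sigma> (at t))) has_integral I2) {T..T + 1}"
    by (rule has_integral_spike[OF negligible_sing[of T] _ I2]) (auto simp: vd2 \<sigma>_def)
  have "((\<lambda>t. ?k (\<sigma> t) (vector_derivative \<sigma> (at t))) has_integral (I1 + I2)) {0..T + 1}"
    using \<open>0 \<le> T\<close> by (intro has_integral_combine[OF _ _ J1 J2]) auto
  moreover have "\<sigma> 0 = q" "\<sigma> (T + 1) = q + T *\<^sub>R n + w" using \<open>0 \<le> T\<close> by (auto simp: \<sigma>_def)
  ultimately have "I1 + I2 \<in> kobayashi_lengths \<Omega> q (q + T *\<^sub>R n + w)"
    unfolding kobayashi_lengths_def mem_Collect_eq using AC im \<open>0 \<le> T\<close>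
    by (intro exI[of _ \<sigma>] exI[of _ "0::real"] exI[of _ "T + 1"] conjI) simp_all
  then show ?thesis
    by (rule bexI[rotated]) (use \<open>I1 \<le> A\<close> \<open>I2 \<le> B\<close> in simp)
qed

lemma kobayashi_length_ge_halfspace:
  fixes q z a :: "complex^'d"
  assumes "open \<Omega>" and lt: "\<And>y. y \<in> \<Omega> \<Longrightarrow> a \<bullet> y < c" and L: "L \<in> kobayashi_lengths \<Omega> q z"
  shows "(ln (c - a \<bullet> z) - ln (c - a \<bullet> q)) / 2 \<le> L"
proof -
  obtain \<sigma> :: "real \<Rightarrow> complex^'d" and l u where lu: "l \<le> u" and AC: "abs_continuous_on l u \<sigma>"
    and im: "\<sigma> ` {l..u} \<subseteq> \<Omega>" and ends: "\<sigma> l = q" "\<sigma> u = z"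
    and int: "((\<lambda>t. kobayashi_metric \<Omega> (\<sigma> t) (vector_derivative \<sigma> (at t))) has_integral L) {l..u}"
    using L by (auto simp: kobayashi_lengths_def)
  have pos: "0 < c - a \<bullet> \<sigma> t" if "t \<in> {l..u}" for t using lt im that by force
  have "continuous_on {l..u} (\<lambda>t. c - a \<bullet> \<sigma> t)"
    by (intro continuous_intros abs_continuous_on_imp_continuous_on[OF AC])
  then have "\<exists>t0\<in>{l..u}. \<forall>t\<in>{l..u}. c - a \<bullet> \<sigma> t0 \<le> c - a \<bullet> \<sigma> t"
    using lu by (intro continuous_attains_inf compact_Icc) auto
  then obtain t0 where t0: "t0 \<in> {l..u}" "\<And>t. t \<in> {l..u} \<Longrightarrow> c - a \<bullet> \<sigma> t0 \<le> c - a \<bullet> \<sigma> t"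
    by blast
  define m where "m = c - a \<bullet> \<sigma> t0"
  have m: "m > 0" using pos t0(1) by (simp add: m_def)
  have mle: "m \<le> c - a \<bullet> \<sigma> t" if "t \<in> {l..u}" for t using t0(2) that by (simp add: m_def)
  define \<phi> where "\<phi> t = ln (c - a \<bullet> \<sigma> t) / 2" for t
  have lndiff: "ln (c - a \<bullet> \<sigma> s) - ln (c - a \<bullet> \<sigma> t) \<le> norm a / m * dist (\<sigma> s) (\<sigma> t)"
    if st: "s \<in> {l..u}" "t \<in> {l..u}" for s t
  proof -
    have "ln (c - a \<bullet> \<sigma> s) - ln (c - a \<bullet> \<sigma> t) \<le> ((c - a \<bullet> \<sigma> s) - (c - a \<bullet> \<sigma> t)) / (c - a \<bullet> \<sigma> t)"
      using ln_diff_le pos st by blast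
    also have "\<dots> \<le> (norm a * dist (\<sigma> s) (\<sigma> t)) / (c - a \<bullet> \<sigma> t)"
    proof (rule divide_right_mono)
      have "(c - a \<bullet> \<sigma> s) - (c - a \<bullet> \<sigma> t) = a \<bullet> (\<sigma> t - \<sigma> s)" by (simp add: inner_diff_right)
      also have "\<dots> \<le> norm a * norm (\<sigma> t - \<sigma> s)" by (rule norm_cauchy_schwarz)
      finally show "(c - a \<bullet> \<sigma> s) - (c - a \<bullet> \<sigma> t) \<le> norm a * dist (\<sigma> s) (\<sigma> t)"
        by (simp add: dist_norm norm_minus_commute)
    qed (use pos[OF st(2)] in simp)
    also have "\<dots> \<le> (norm a * dist (\<sigma> s) (\<sigma> t)) / m"
      using m mle[OF st(2)] by (intro divide_left_mono mult_nonneg_nonneg mult_pos_pos) auto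
    finally show ?thesis by simp
  qed
  have "abs_continuous_on l u \<phi>"
    unfolding \<phi>_def
  proof (rule abs_continuous_on_lipschitz[OF AC, where C = "norm a / m" and g = "\<lambda>y. ln (c - a \<bullet> y) / 2"])
    show "0 \<le> norm a / m" using m by simp
    fix s t assume st: "s \<in> {l..u}" "t \<in> {l..u}"
    have "0 \<le> norm a / m * dist (\<sigma> s) (\<sigma> t)" using m by simp
    then show "dist (ln (c - a \<bullet> \<sigma> s) / 2) (ln (c - a \<bullet> \<sigma> t) / 2) \<le> norm a / m * dist (\<sigma> s) (\<sigma> t)"
      using lndiff[OF st] lndiff[OF st(2,1)] unfolding dist_commute[of "\<sigma> t" "\<sigma> s"] dist_real_def by linarith
  qed
  then have "\<phi> u - \<phi> l \<le> L"
  proof (rule has_integral_ge_increment[OF _ lu abs_continuous_on_differentiable_ae[OF AC] int])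
    fix t assume "t \<in> {l..u} - {x \<in> {l..u}. \<not> \<sigma> differentiable at x}"
    then have t: "t \<in> {l..u}" "\<sigma> differentiable at t" by auto
    define D where "D = vector_derivative \<sigma> (at t)"
    have "(\<sigma> has_vector_derivative D) (at t)"
      using t(2) by (simp add: D_def vector_derivative_works)
    then have "((\<lambda>t. a \<bullet> \<sigma> t) has_vector_derivative a \<bullet> D) (at t)"
      by (rule bounded_linear.has_vector_derivative[OF bounded_linear_inner_right])
    then have "((\<lambda>t. a \<bullet> \<sigma> t) has_real_derivative a \<bullet> D) (at t)"
      by (simp add: has_real_derivative_iff_has_vector_derivative)
    then have "(\<phi> has_real_derivative - (a \<bullet> D) / (2 * (c - a \<bullet> \<sigma> t))) (at t)"
      unfolding \<phi>_def using pos[OF t(1)] by (auto intro!: derivative_eq_intros simp: field_simps)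
    moreover have "- (a \<bullet> D) / (2 * (c - a \<bullet> \<sigma> t)) \<le> \<bar>a \<bullet> D\<bar> / (2 * (c - a \<bullet> \<sigma> t))"
      using pos[OF t(1)] by (intro divide_right_mono) auto
    moreover have "\<dots> \<le> kobayashi_metric \<Omega> (\<sigma> t) D"
      using im t(1) by (intro kobayashi_metric_ge_halfspace assms(1) lt) auto
    ultimately show "\<exists>D. (\<phi> has_real_derivative D) (at t) \<and> D \<le> kobayashi_metric \<Omega> (\<sigma> t) (vector_derivative \<sigma> (at t))"
      unfolding D_def by (meson order_trans)
  qed
  then show ?thesis by (simp add: \<phi>_def ends diff_divide_distrib)
qed

section \<open>Boundary distance and cones at smooth boundary points\<close>

lemma boundary_dist_ge:
  fixes \<Omega> :: "'a::euclidean_space set"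
  assumes \<Omega>: "open \<Omega>" "\<Omega> \<noteq> {}" "bounded \<Omega>" and "ball q m \<subseteq> \<Omega>"
  shows "m \<le> boundary_dist \<Omega> q"
proof -
  have ne: "frontier \<Omega> \<noteq> {}" using frontier_eq_empty[of \<Omega>] \<Omega> by auto
  have "m \<le> dist q w" if "w \<in> frontier \<Omega>" for w
  proof (rule ccontr)
    assume "\<not> m \<le> dist q w"
    then have "w \<in> \<Omega>" using assms(4) by auto
    then show False using that \<Omega>(1) by (simp add: frontier_def interior_open)
  qed
  then show ?thesis
    unfolding boundary_dist_def infdist_notempty[OF ne] by (intro cINF_greatest ne) auto
qed

lemma boundary_dist_ball_subset:
  fixes \<Omega> :: "'a::euclidean_space set"
  assumes "q \<in> \<Omega>"
  shows "ball q (boundary_dist \<Omega> q) \<subseteq> \<Omega>"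
proof (rule ccontr)
  let ?B = "ball q (boundary_dist \<Omega> q)"
  assume "\<not> ?B \<subseteq> \<Omega>"
  then have ne: "?B - \<Omega> \<noteq> {}" by auto
  then have "q \<in> ?B" by (metis Diff_empty all_not_in_conv ball_eq_empty centre_in_ball empty_Diff not_le)
  then have "?B \<inter> frontier \<Omega> \<noteq> {}"
    using connected_Int_frontier[of ?B \<Omega>] ne assms connected_ball by blast
  then obtain w where "w \<in> frontier \<Omega>" "dist q w < boundary_dist \<Omega> q" by auto
  then show False using infdist_le[of w "frontier \<Omega>" q] by (simp add: boundary_dist_def)
qed

lemma boundary_dist_pos:
  fixes \<Omega> :: "'a::euclidean_space set"
  assumes \<Omega>: "open \<Omega>" "bounded \<Omega>" "q \<in> \<Omega>"
  shows "0 < boundary_dist \<Omega> q"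
proof -
  obtain m where "m > 0" "ball q m \<subseteq> \<Omega>" using \<Omega> openE by blast
  then show ?thesis using boundary_dist_ge[of \<Omega> q m] \<Omega> by force
qed

lemma cball_boundary_dist_subset_closure:
  fixes \<Omega> :: "'a::euclidean_space set"
  assumes \<Omega>: "open \<Omega>" "bounded \<Omega>" "q \<in> \<Omega>"
  shows "cball q (boundary_dist \<Omega> q) \<subseteq> closure \<Omega>"
  using closure_mono[OF boundary_dist_ball_subset[OF \<Omega>(3)]] boundary_dist_pos[OF assms] by simp

lemma boundary_dist_bounded:
  fixes \<Omega> :: "'a::euclidean_space set"
  assumes \<Omega>: "open \<Omega>" "bounded \<Omega>"
  obtains D where "1 \<le> D" "\<And>q. q \<in> \<Omega> \<Longrightarrow> boundary_dist \<Omega> q \<le> D" "\<And>x y. x \<in> \<Omega> \<Longrightarrow> y \<in> \<Omega> \<Longrightarrow> norm (x - y) \<le> D"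
proof (cases "\<Omega> = {}")
  case True
  then show thesis using that[of 1] by auto
next
  case False
  then have "frontier \<Omega> \<noteq> {}" using frontier_eq_empty[of \<Omega>] \<Omega> by auto
  then obtain w where w: "w \<in> frontier \<Omega>" by blast
  have b: "bounded (closure \<Omega>)" using \<Omega>(2) by (rule bounded_closure)
  have d: "dist x y \<le> diameter (closure \<Omega>)" if "x \<in> closure \<Omega>" "y \<in> closure \<Omega>" for x y
    using diameter_bounded_bound[OF b that] .
  show thesis
  proof (rule that[of "max 1 (diameter (closure \<Omega>))"])
    show "boundary_dist \<Omega> q \<le> max 1 (diameter (closure \<Omega>))" if "q \<in> \<Omega>" for q
    proof -
      have "boundary_dist \<Omega> q \<le> dist q w" unfolding boundary_dist_def by (rule infdist_le[OF w])
      also have "\<dots> \<le> diameter (closure \<Omega>)" 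
        using w that closure_subset[of \<Omega>] by (intro d) (auto simp: frontier_def)
      finally show ?thesis by simp
    qed
    show "norm (x - y) \<le> max 1 (diameter (closure \<Omega>))" if "x \<in> \<Omega>" "y \<in> \<Omega>" for x y
      using d[of x y] that closure_subset[of \<Omega>] by (simp add: dist_norm subset_iff le_max_iff_disj)
  qed simp
qed

lemma convex_ball_segment_subset:
  fixes x y :: "'a::real_normed_vector"
  assumes "convex \<Omega>" "ball x m \<subseteq> \<Omega>" "ball y m \<subseteq> \<Omega>" "0 \<le> t" "t \<le> 1"
  shows "ball (x + t *\<^sub>R (y - x)) m \<subseteq> \<Omega>"
proof
  fix z assume z: "z \<in> ball (x + t *\<^sub>R (y - x)) m"
  define h where "h = z - (x + t *\<^sub>R (y - x))"
  have h: "norm h < m" using z by (simp add: h_def dist_norm norm_minus_commute)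
  have "x + h \<in> \<Omega>" "y + h \<in> \<Omega>" using assms(2,3) h by (auto simp: dist_norm)
  then have "(1 - t) *\<^sub>R (x + h) + t *\<^sub>R (y + h) \<in> \<Omega>"
    using assms(1,4,5) by (intro convexD) auto
  moreover have "(1 - t) *\<^sub>R (x + h) + t *\<^sub>R (y + h) = z" by (simp add: h_def algebra_simps)
  ultimately show "z \<in> \<Omega>" by simp
qed

lemma C1_boundary_cone:
  fixes \<Omega> :: "(complex^'d) set"
  assumes "C1_boundary \<Omega>" and p0: "p0 \<in> frontier \<Omega>" and \<kappa>: "0 < \<kappa>" "\<kappa> < 1"
  obtains n t0 \<rho> where "norm n = 1" "0 < t0" "0 < \<rho>"
    "\<And>p w s. p \<in> closure \<Omega> \<Longrightarrow> dist p0 p < \<rho> \<Longrightarrow> \<kappa> \<le> Re w \<Longrightarrow> cmod w \<le> 1 / \<kappa> \<Longrightarrow> 0 < s \<Longrightarrow> s \<le> t0 \<Longrightarrow>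
       p + (of_real s * w) *s n \<in> \<Omega>"
proof -
  obtain U r g where U: "open U" "p0 \<in> U"
    and der: "\<And>x. x \<in> U \<Longrightarrow> (r has_derivative (\<lambda>h. g x \<bullet> h)) (at x)" and g0: "\<And>x. x \<in> U \<Longrightarrow> g x \<noteq> 0"
    and cont: "continuous_on U g" and sub: "\<Omega> \<inter> U = {x\<in>U. r x < (0::real)}"
    using assms(1)[unfolded C1_boundary_def, rule_format, OF p0]
    by (elim exE conjE) (rule that, simp_all)
  define N where "N = norm (g p0)"
  have N: "N > 0" using g0[OF U(2)] by (simp add: N_def)
  define n where "n = of_real (- 1 / N) *s g p0"
  have nn: "norm n = 1" using N by (simp add: n_def norm_smult_complex_vec N_def norm_divide)
  obtain R1 where R1: "R1 > 0" "ball p0 R1 \<subseteq> U" using U openE by blast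
  have "\<kappa>\<^sup>2 * N > 0" using \<kappa> N by simp
  then obtain R2 where R2: "R2 > 0" "\<And>x. x \<in> U \<Longrightarrow> dist x p0 < R2 \<Longrightarrow> dist (g x) (g p0) < \<kappa>\<^sup>2 * N"
    using cont U(2) unfolding continuous_on_iff by meson
  define R where "R = min R1 R2"
  have R: "R > 0" "ball p0 R \<subseteq> U" "\<And>x. x \<in> ball p0 R \<Longrightarrow> norm (g x - g p0) < \<kappa>\<^sup>2 * N"
    using R1 R2 by (auto simp: R_def dist_norm norm_minus_commute subset_iff)
  define t0 where "t0 = \<kappa> * R / 4"
  show thesis
  proof (rule that[of n t0 "R/2"])
    fix p w s assume p: "p \<in> closure \<Omega>" "dist p0 p < R/2" and w: "\<kappa> \<le> Re w" "cmod w \<le> 1 / \<kappa>"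
      and s: "0 < s" "s \<le> t0"
    define u where "u = (of_real s * w) *s n"
    have "norm u = s * cmod w" using s nn by (simp add: u_def norm_smult_complex_vec norm_mult)
    also have "\<dots> \<le> t0 * (1 / \<kappa>)" using s w by (intro mult_mono) auto
    also have "\<dots> = R / 4" using \<kappa> by (simp add: t0_def)
    finally have nu: "norm u \<le> R / 4" .
    have inball: "p + \<tau> *\<^sub>R u \<in> ball p0 R" if "0 \<le> \<tau>" "\<tau> \<le> 1" for \<tau>
    proof -
      have "norm (\<tau> *\<^sub>R u) \<le> norm u" using that by (simp add: mult_left_le_one_le)
      then have "norm (\<tau> *\<^sub>R u) \<le> R / 4" using nu by simp
      moreover have "dist p0 (p + \<tau> *\<^sub>R u) \<le> dist p0 p + norm (\<tau> *\<^sub>R u)"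
        using dist_triangle[of p0 "p + \<tau> *\<^sub>R u" p] by (simp add: dist_norm)
      ultimately show ?thesis using p(2) R(1) by simp
    qed
    have neg: "g x \<bullet> u < 0" if x: "x \<in> ball p0 R" for x
    proof -
      define y where "y = w *s n"
      have "u = s *\<^sub>R y" by (simp only: u_def y_def vector_smult_assoc[symmetric] of_real_smult_complex_vec)
      have "g p0 \<bullet> y = Re (w * of_real (- 1 / N)) * (norm (g p0))\<^sup>2"
        unfolding y_def n_def vector_smult_assoc by (rule inner_smult_complex_vec)
      also have "\<dots> = - Re w * N" using N by (simp add: N_def power2_eq_square)
      also have "\<dots> \<le> - (\<kappa> * N)" using w N by simp
      finally have 1: "g p0 \<bullet> y \<le> - (\<kappa> * N)" .
      have "norm y \<le> 1 / \<kappa>" using w nn by (simp add: y_def norm_smult_complex_vec)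
      have "(g x - g p0) \<bullet> y \<le> norm (g x - g p0) * norm y" by (rule norm_cauchy_schwarz)
      also have "\<dots> \<le> norm (g x - g p0) * (1 / \<kappa>)"
        using \<open>norm y \<le> 1 / \<kappa>\<close> by (intro mult_left_mono) auto
      also have "\<dots> < (\<kappa>\<^sup>2 * N) * (1 / \<kappa>)"
        using R(3)[OF x] \<kappa> by (intro mult_strict_right_mono) auto
      also have "\<dots> = \<kappa> * N" using \<kappa> by (simp add: power2_eq_square)
      finally have "g x \<bullet> y < 0" using 1 by (simp add: inner_diff_left)
      then show ?thesis using s by (simp add: \<open>u = s *\<^sub>R y\<close> mult_pos_neg)
    qed
    have rp: "r p \<le> 0"
    proof (rule ccontr)
      assume "\<not> r p \<le> 0"
      have pU: "p \<in> U" using inball[of 0] R(2) by auto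
      have "isCont r p" using der[OF pU] by (rule has_derivative_continuous)
      then have "eventually (\<lambda>x. 0 < r x) (nhds p)"
        using \<open>\<not> r p \<le> 0\<close> by (intro order_tendstoD(1)[of r "r p"]) (auto simp: isCont_def tendsto_at_iff_tendsto_nhds)
      moreover have "eventually (\<lambda>x. x \<in> U) (nhds p)" using U(1) pU by (simp add: eventually_nhds_in_open)
      ultimately have "eventually (\<lambda>x. 0 < r x \<and> x \<in> U) (nhds p)" by (rule eventually_conj)
      then obtain S where "open S" "p \<in> S" "\<And>x. x \<in> S \<Longrightarrow> 0 < r x \<and> x \<in> U"
        unfolding eventually_nhds by blast
      moreover then obtain x where "x \<in> S" "x \<in> \<Omega>"
        using p(1) closure_iff_nhds_not_empty[of p \<Omega>] by blast
      ultimately show False using sub by force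
    qed
    have "r (p + 0 *\<^sub>R u) > r (p + 1 *\<^sub>R u)"
    proof (rule DERIV_neg_imp_decreasing[of 0 1 "\<lambda>\<tau>. r (p + \<tau> *\<^sub>R u)"], simp)
      fix \<tau> :: real assume "0 \<le> \<tau>" "\<tau> \<le> 1"
      then have b: "p + \<tau> *\<^sub>R u \<in> ball p0 R" by (rule inball)
      then have "p + \<tau> *\<^sub>R u \<in> U" using R(2) by blast
      have line: "((\<lambda>\<tau>. p + \<tau> *\<^sub>R u) has_derivative (\<lambda>h. h *\<^sub>R u)) (at \<tau>)"
        by (auto intro!: derivative_eq_intros)
      have "((\<lambda>\<tau>. r (p + \<tau> *\<^sub>R u)) has_derivative (\<lambda>h. g (p + \<tau> *\<^sub>R u) \<bullet> (h *\<^sub>R u))) (at \<tau>)"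
        by (rule has_derivative_compose[OF line der[OF \<open>p + \<tau> *\<^sub>R u \<in> U\<close>]])
      then have "((\<lambda>\<tau>. r (p + \<tau> *\<^sub>R u)) has_real_derivative g (p + \<tau> *\<^sub>R u) \<bullet> u) (at \<tau>)"
        by (simp add: has_field_derivative_def mult_commute_abs mult.commute)
      then show "\<exists>y. ((\<lambda>\<tau>. r (p + \<tau> *\<^sub>R u)) has_real_derivative y) (at \<tau>) \<and> y < 0"
        using neg[OF b] by blast
    qed
    then have "r (p + u) < 0" using rp by simp
    moreover have "p + u \<in> U" using inball[of 1] R(2) by auto
    ultimately show "p + (of_real s * w) *s n \<in> \<Omega>" using sub by (auto simp: u_def)
  qed (use R(1) \<kappa> nn in \<open>auto simp: t0_def\<close>)
qed

section \<open>The Kobayashi distance near the boundary\<close>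

lemma kobayashi_dist_le_two_segments:
  fixes q n z :: "complex^'d"
  assumes \<Omega>: "open \<Omega>" "bounded \<Omega>" "convex \<Omega>" and "0 \<le> T" "0 < m" and q: "q \<in> \<Omega>" 
    and balls: "ball (q + T *\<^sub>R n) m \<subseteq> \<Omega>" "ball z m \<subseteq> \<Omega>"
    and g: "\<And>t. 0 \<le> t \<Longrightarrow> t \<le> T \<Longrightarrow> kobayashi_metric \<Omega> (q + t *\<^sub>R n) n \<le> g t" "(g has_integral A) {0..T}"
    and D: "norm (z - (q + T *\<^sub>R n)) \<le> D"
  shows "kobayashi_dist \<Omega> q z \<le> A + D / m"
proof -
  let ?w = "z - (q + T *\<^sub>R n)"
  have "q + T *\<^sub>R n \<in> \<Omega>" "z \<in> \<Omega>" using balls \<open>0 < m\<close> by (auto simp: subset_iff)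
  moreover have "kobayashi_metric \<Omega> (q + T *\<^sub>R n + t *\<^sub>R ?w) ?w \<le> D / m" if t: "0 \<le> t" "t \<le> 1" for t
  proof -
    have "kobayashi_metric \<Omega> (q + T *\<^sub>R n + t *\<^sub>R ?w) ?w \<le> norm ?w / m"
      by (intro kobayashi_metric_ball_le convex_ball_segment_subset \<Omega> balls t \<open>0 < m\<close>)
    also have "\<dots> \<le> D / m" using D \<open>0 < m\<close> by (intro divide_right_mono) auto
    finally show ?thesis .
  qed
  ultimately have "\<exists>L \<in> kobayashi_lengths \<Omega> q (q + T *\<^sub>R n + ?w). L \<le> A + D / m"
    by (intro kobayashi_length_two_segments[OF \<Omega> \<open>0 \<le> T\<close> q _ _ g]) auto
  then obtain L where "L \<in> kobayashi_lengths \<Omega> q z" "L \<le> A + D / m" by auto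
  then show ?thesis using kobayashi_dist_le[OF \<Omega>(1)] order_trans by blast
qed

lemma kobayashi_lengths_nonempty:
  fixes x y :: "complex^'d"
  assumes \<Omega>: "open \<Omega>" "bounded \<Omega>" "convex \<Omega>" and "x \<in> \<Omega>" "y \<in> \<Omega>"
  shows "kobayashi_lengths \<Omega> x y \<noteq> {}"
proof -
  obtain m1 m2 where "m1 > 0" "ball x m1 \<subseteq> \<Omega>" "m2 > 0" "ball y m2 \<subseteq> \<Omega>"
    using assms openE by metis
  then have m: "min m1 m2 > 0" "ball x (min m1 m2) \<subseteq> \<Omega>" "ball y (min m1 m2) \<subseteq> \<Omega>" by auto
  have "kobayashi_metric \<Omega> (x + t *\<^sub>R (y - x)) (y - x) \<le> norm (y - x) / min m1 m2" if t: "0 \<le> t" "t \<le> 1" for t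
    by (intro kobayashi_metric_ball_le convex_ball_segment_subset \<Omega> m t)
  then have "\<exists>L \<in> kobayashi_lengths \<Omega> x (x + 0 *\<^sub>R 0 + (y - x)). L \<le> 0 + norm (y - x) / min m1 m2"
    using assms by (intro kobayashi_length_two_segments[OF \<Omega>, where g = "\<lambda>t. kobayashi_metric \<Omega> (x + t *\<^sub>R 0) 0"])
      (auto intro: has_integral_refl)
  then show ?thesis by auto
qed

lemma kobayashi_dist_local_bound:
  fixes \<Omega> :: "(complex^'d) set"
  assumes \<Omega>: "open \<Omega>" "bounded \<Omega>" "convex \<Omega>" and C1: "C1_boundary \<Omega>"
    and "0 < e" and z0: "z0 \<in> \<Omega>" and p0: "p0 \<in> closure \<Omega>"
  shows "\<exists>V B. open V \<and> p0 \<in> V \<and> (\<forall>q\<in>V \<inter> \<Omega>. kobayashi_dist \<Omega> q z0 \<le> B + (1 + e) / 2 * ln (1 / boundary_dist \<Omega> q))"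
proof -
  obtain D where D: "1 \<le> D" "\<And>q. q \<in> \<Omega> \<Longrightarrow> boundary_dist \<Omega> q \<le> D" "\<And>x y. x \<in> \<Omega> \<Longrightarrow> y \<in> \<Omega> \<Longrightarrow> norm (x - y) \<le> D"
    using boundary_dist_bounded[OF \<Omega>(1,2)] by blast
  obtain mz where mz: "mz > 0" "ball z0 mz \<subseteq> \<Omega>" using \<Omega>(1) z0 openE by blast
  show ?thesis
  proof (cases "p0 \<in> \<Omega>")
    case True
    then obtain m where m: "m > 0" "ball p0 m \<subseteq> \<Omega>" using \<Omega>(1) openE by blast
    define m' where "m' = min (m / 2) mz"
    have m': "m' > 0" "ball z0 m' \<subseteq> \<Omega>" using m mz by (auto simp: m'_def)
    have "kobayashi_dist \<Omega> q z0 \<le> (D / m' + (1 + e) / 2 * ln D) + (1 + e) / 2 * ln (1 / boundary_dist \<Omega> q)"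
      if q: "q \<in> ball p0 (m / 2) \<inter> \<Omega>" for q
    proof -
      have "ball q m' \<subseteq> ball p0 m"
      proof
        fix x assume "x \<in> ball q m'"
        then show "x \<in> ball p0 m" using q dist_triangle[of p0 x q] by (simp add: m'_def)
      qed
      then have "ball (q + 0 *\<^sub>R 0) m' \<subseteq> \<Omega>" using m by auto
      then have "kobayashi_dist \<Omega> q z0 \<le> 0 + D / m'"
        using q D(3)[OF z0, of q]
        by (intro kobayashi_dist_le_two_segments[OF \<Omega> order_refl m'(1) _ _ m'(2), where g = "\<lambda>t. kobayashi_metric \<Omega> (q + t *\<^sub>R 0) 0"])
          (auto intro: has_integral_refl)
      moreover have "ln (1 / boundary_dist \<Omega> q) \<ge> - ln D"
        using D(2)[of q] q boundary_dist_pos[OF \<Omega>(1,2), of q] D(1) by (simp add: ln_div)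
      then have "(1 + e) / 2 * (- ln D) \<le> (1 + e) / 2 * ln (1 / boundary_dist \<Omega> q)"
        using \<open>0 < e\<close> by (intro mult_left_mono) auto
      ultimately show ?thesis by simp
    qed
    then show ?thesis
      using m(1) by (intro exI[of _ "ball p0 (m / 2)"] exI[of _ "D / m' + (1 + e) / 2 * ln D"] conjI ballI) simp_all
  next
    case False
    then have p0': "p0 \<in> frontier \<Omega>" using p0 \<Omega>(1) by (simp add: frontier_def interior_open)
    define r where "r = 1 / (1 + e)"
    have r: "0 < r" "r < 1" using \<open>0 < e\<close> by (auto simp: r_def)
    define \<kappa> where "\<kappa> = (1 - r) / (1 + r)"
    have \<kappa>: "0 < \<kappa>" "\<kappa> < 1" "1 / \<kappa> = (1 + r) / (1 - r)" using r by (auto simp: \<kappa>_def)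
    obtain n t0 \<rho> where n: "norm n = 1" and t0: "0 < t0" and \<rho>: "0 < \<rho>" and cone:
      "\<And>p w s. p \<in> closure \<Omega> \<Longrightarrow> dist p0 p < \<rho> \<Longrightarrow> \<kappa> \<le> Re w \<Longrightarrow> cmod w \<le> 1 / \<kappa> \<Longrightarrow> 0 < s \<Longrightarrow> s \<le> t0 \<Longrightarrow>
         p + (of_real s * w) *s n \<in> \<Omega>"
      using C1_boundary_cone[OF C1 p0' \<kappa>(1,2)] by metis
    have "p0 + (of_real t0 * 1) *s n \<in> \<Omega>"
      using \<kappa>(1,2) t0 \<rho> p0 by (intro cone) auto
    then obtain m where m: "m > 0" "ball (p0 + t0 *\<^sub>R n) m \<subseteq> \<Omega>"
      using \<Omega>(1) openE unfolding mult_1_right of_real_smult_complex_vec by blast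
    define m' where "m' = min (m / 2) mz"
    have m': "m' > 0" "ball z0 m' \<subseteq> \<Omega>" using m mz by (auto simp: m'_def)
    define R where "R = min (\<rho> / 2) (min t0 (m / 4))"
    have R: "R > 0" using \<rho> t0 m by (simp add: R_def)
    have "kobayashi_dist \<Omega> q z0 \<le> (D / m' + (1 + e) / 2 * ln t0) + (1 + e) / 2 * ln (1 / boundary_dist \<Omega> q)"
      if q: "q \<in> ball p0 R \<inter> \<Omega>" for q
    proof -
      define \<delta> where "\<delta> = boundary_dist \<Omega> q"
      have \<delta>: "\<delta> > 0" unfolding \<delta>_def using q \<Omega> by (intro boundary_dist_pos) auto
      have "\<delta> \<le> dist q p0" unfolding \<delta>_def boundary_dist_def by (rule infdist_le[OF p0'])
      then have \<delta>R: "\<delta> < R" using q by (simp add: dist_commute)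
      define p where "p = q - \<delta> *\<^sub>R n"
      have dqp: "dist q p = \<delta>" using n \<delta> by (simp add: p_def dist_norm)
      have "p \<in> cball q \<delta>" using dqp by simp
      then have pcl: "p \<in> closure \<Omega>"
        using cball_boundary_dist_subset_closure[OF \<Omega>(1,2), of q] q unfolding \<delta>_def by blast
      have dpp: "dist p0 p < 2 * R"
        using dist_triangle[of p0 p q] q dqp \<delta>R by simp
      define T where "T = t0 - \<delta>"
      have T: "0 \<le> T" using \<delta>R by (simp add: T_def R_def)
      have qT: "q + t *\<^sub>R n = p + of_real (\<delta> + t) *s n" for t
        by (simp only: p_def of_real_smult_complex_vec) (simp add: algebra_simps)
      have "ball (q + T *\<^sub>R n) m' \<subseteq> ball (p0 + t0 *\<^sub>R n) m"
      proof
        fix x assume x: "x \<in> ball (q + T *\<^sub>R n) m'"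
        have "q + T *\<^sub>R n = p + t0 *\<^sub>R n" by (simp add: T_def p_def algebra_simps)
        then have "dist (p0 + t0 *\<^sub>R n) (q + T *\<^sub>R n) = dist p0 p" by simp
        then have "dist (p0 + t0 *\<^sub>R n) (q + T *\<^sub>R n) < m / 2" using dpp by (simp add: R_def)
        moreover have "dist (q + T *\<^sub>R n) x < m / 2" using x by (simp add: m'_def)
        ultimately show "x \<in> ball (p0 + t0 *\<^sub>R n) m"
          using dist_triangle[of "p0 + t0 *\<^sub>R n" x "q + T *\<^sub>R n"] by simp
      qed
      then have ball: "ball (q + T *\<^sub>R n) m' \<subseteq> \<Omega>" using m by auto
      have g: "kobayashi_metric \<Omega> (q + t *\<^sub>R n) n \<le> 1 / (2 * r * (\<delta> + t))" if "0 \<le> t" "t \<le> T" for t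
        unfolding qT
      proof (rule kobayashi_metric_cone_le[OF r])
        show "0 < \<delta> + t" using \<delta> that by simp
        fix w assume "(1 - r) / (1 + r) \<le> Re w" "cmod w \<le> (1 + r) / (1 - r)"
        then show "p + (of_real (\<delta> + t) * w) *s n \<in> \<Omega>"
          using that \<delta> dpp pcl unfolding \<kappa>_def[symmetric] \<kappa>(3)[symmetric]
          by (intro cone) (simp_all add: R_def T_def)
      qed
      have int: "((\<lambda>t. 1 / (2 * r * (\<delta> + t))) has_integral ln (\<delta> + T) / (2 * r) - ln (\<delta> + 0) / (2 * r)) {0..T}"
      proof (rule fundamental_theorem_of_calculus[OF T])
        fix t assume "t \<in> {0..T}"
        then have "((\<lambda>t. ln (\<delta> + t)) has_real_derivative 1 / (\<delta> + t)) (at t within {0..T})"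
          using \<delta> by (auto intro!: derivative_eq_intros)
        then have "((\<lambda>t. ln (\<delta> + t) / (2 * r)) has_real_derivative 1 / (\<delta> + t) / (2 * r)) (at t within {0..T})"
          by (rule DERIV_cdivide)
        then have "((\<lambda>t. ln (\<delta> + t) / (2 * r)) has_real_derivative 1 / (2 * r * (\<delta> + t))) (at t within {0..T})"
          by (simp only: divide_divide_eq_left mult.commute[of "\<delta> + t"])
        then show "((\<lambda>t. ln (\<delta> + t) / (2 * r)) has_vector_derivative 1 / (2 * r * (\<delta> + t))) (at t within {0..T})"
          by (simp add: has_real_derivative_iff_has_vector_derivative)
      qed
      have "q + T *\<^sub>R n \<in> \<Omega>" using ball m'(1) by (auto simp: subset_iff)
      then have "kobayashi_dist \<Omega> q z0 \<le> (ln (\<delta> + T) / (2 * r) - ln (\<delta> + 0) / (2 * r)) + D / m'"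
        using q by (intro kobayashi_dist_le_two_segments[OF \<Omega> T m'(1) _ ball m'(2) g int] D(3) z0) auto
      also have "ln (\<delta> + T) / (2 * r) - ln (\<delta> + 0) / (2 * r) = (1 + e) / 2 * ln t0 + (1 + e) / 2 * ln (1 / \<delta>)"
        using \<delta> \<open>0 < e\<close> by (simp add: T_def r_def ln_div algebra_simps add_divide_distrib)
      finally show ?thesis by (simp add: \<delta>_def)
    qed
    then show ?thesis
      using R by (intro exI[of _ "ball p0 R"] exI[of _ "D / m' + (1 + e) / 2 * ln t0"] conjI ballI) simp_all
  qed
qed

lemma kobayashi_dist_log_upper_bound:
  fixes \<Omega> :: "(complex^'d) set"
  assumes \<Omega>: "open \<Omega>" "bounded \<Omega>" "convex \<Omega>" and C1: "C1_boundary \<Omega>"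
    and "0 < e" and z0: "z0 \<in> \<Omega>"
  shows "\<exists>B>0. \<forall>q\<in>\<Omega>. kobayashi_dist \<Omega> q z0 \<le> B + (1 + e) / 2 * ln (1 / boundary_dist \<Omega> q)"
proof -
  let ?P = "\<lambda>B q. kobayashi_dist \<Omega> q z0 \<le> B + (1 + e) / 2 * ln (1 / boundary_dist \<Omega> q)"
  have "\<forall>p\<in>closure \<Omega>. \<exists>V B. open V \<and> p \<in> V \<and> (\<forall>q\<in>V \<inter> \<Omega>. ?P B q)"
    using kobayashi_dist_local_bound[OF \<Omega> C1 \<open>0 < e\<close> z0] by blast
  then obtain V B where V: "\<And>p. p \<in> closure \<Omega> \<Longrightarrow> open (V p) \<and> p \<in> V p \<and> (\<forall>q\<in>V p \<inter> \<Omega>. ?P (B p) q)"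
    by metis
  have "compact (closure \<Omega>)" using \<Omega>(2) by (simp add: compact_closure)
  then obtain F where F: "F \<subseteq> closure \<Omega>" "finite F" "closure \<Omega> \<subseteq> (\<Union>p\<in>F. V p)"
    by (rule compactE_image[of _ "closure \<Omega>" V]) (use V in auto)
  define M where "M = (\<Sum>p\<in>F. \<bar>B p\<bar>) + 1"
  have "0 \<le> (\<Sum>p\<in>F. \<bar>B p\<bar>)" by (rule sum_nonneg) simp
  then have "M > 0" unfolding M_def by linarith
  moreover have "?P M q" if q: "q \<in> \<Omega>" for q
  proof -
    have "q \<in> closure \<Omega>" using q closure_subset by blast
    then obtain p where p: "p \<in> F" "q \<in> V p" using F(3) by blast
    have "?P (B p) q" using V[of p] p F(1) q by blast
    moreover have "\<bar>B p\<bar> \<le> (\<Sum>p\<in>F. \<bar>B p\<bar>)" using F(2) p(1) by (intro member_le_sum) auto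
    ultimately show ?thesis by (simp add: M_def)
  qed
  ultimately show ?thesis by blast
qed

lemma alpha_regular_ge_one:
  fixes \<Omega> :: "(complex^'d) set"
  assumes \<Omega>: "open \<Omega>" "bounded \<Omega>" "convex \<Omega>" "\<Omega> \<noteq> {}" and reg: "alpha_regular \<alpha> \<Omega>" "0 < \<alpha>"
  shows "1 \<le> \<alpha>"
proof (rule ccontr)
  assume "\<not> 1 \<le> \<alpha>"
  obtain z where z: "z \<in> \<Omega>" using \<Omega>(4) by blast
  obtain m where m: "m > 0" "ball z m \<subseteq> \<Omega>" using \<Omega>(1) z openE by blast
  have "frontier \<Omega> \<noteq> {}" using frontier_eq_empty[of \<Omega>] \<Omega> by auto
  then obtain p where p: "p \<in> frontier \<Omega>" by blast
  then have pn: "p \<notin> \<Omega>" and pc: "p \<in> closure \<Omega>" using \<Omega>(1) by (auto simp: frontier_def interior_open)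
  obtain a where a: "a \<noteq> 0" and lt: "\<And>y. y \<in> \<Omega> \<Longrightarrow> a \<bullet> y < a \<bullet> p"
  proof -
    obtain a b where ab: "a \<noteq> 0" "\<forall>x\<in>\<Omega>. a \<bullet> x \<le> b" "\<forall>x\<in>{p}. b \<le> a \<bullet> x"
      using separating_hyperplane_sets[of \<Omega> "{p}"] \<Omega> pn by auto
    have "a \<bullet> y < a \<bullet> p" if y: "y \<in> \<Omega>" for y
    proof -
      obtain k where k: "k > 0" "ball y k \<subseteq> \<Omega>" using openE[OF \<Omega>(1) y] by blast
      define c where "c = k / (2 * norm a)"
      have c: "c > 0" using k ab(1) by (simp add: c_def)
      have "y + c *\<^sub>R a \<in> ball y k" using k ab(1) by (simp add: dist_norm c_def)
      then have "a \<bullet> (y + c *\<^sub>R a) \<le> a \<bullet> p" using k(2) ab(2,3) by (meson dual_order.trans singletonI subsetD)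
      moreover have "0 < c * (a \<bullet> a)" using c ab(1) by simp
      ultimately show ?thesis by (simp add: inner_add_right)
    qed
    then show thesis using that ab(1) by blast
  qed
  obtain B where B: "\<And>q. q \<in> \<Omega> \<Longrightarrow> kobayashi_dist \<Omega> q z \<le> B + \<alpha> / 2 * ln (1 / boundary_dist \<Omega> q)"
    using reg z unfolding alpha_regular_def by blast
  have bound: "ln (1 / s) / 2 \<le> B + \<alpha> / 2 * (ln (1 / s) + ln (1 / m))" if s: "0 < s" "s < 1" for s
  proof -
    define q where "q = p + s *\<^sub>R (z - p)"
    have "ball q (s * m) \<subseteq> \<Omega>"
    proof
      fix x assume x: "x \<in> ball q (s * m)"
      define y where "y = z + (1 / s) *\<^sub>R (x - q)"
      have "norm ((1 / s) *\<^sub>R (x - q)) < m"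
        using x s by (simp add: dist_norm norm_minus_commute pos_divide_less_eq mult.commute)
      then have "y \<in> ball z m" by (simp add: y_def dist_norm)
      then have "y \<in> interior \<Omega>" using m \<Omega>(1) by (auto simp: interior_open)
      then have "p - s *\<^sub>R (p - y) \<in> interior \<Omega>"
        using s \<Omega>(3) pc by (intro mem_interior_closure_convex_shrink) auto
      moreover have "p - s *\<^sub>R (p - y) = x" using s by (simp add: y_def q_def algebra_simps)
      ultimately show "x \<in> \<Omega>" using \<Omega>(1) by (simp add: interior_open)
    qed
    then have q: "q \<in> \<Omega>" and sm: "s * m \<le> boundary_dist \<Omega> q"
      using s m boundary_dist_ge[OF \<Omega>(1,4,2)] by (auto simp: subset_iff)
    have "ln (1 / s) / 2 = (ln (a \<bullet> p - a \<bullet> z) - ln (a \<bullet> p - a \<bullet> q)) / 2"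
    proof -
      have "a \<bullet> p - a \<bullet> q = s * (a \<bullet> p - a \<bullet> z)" by (simp add: q_def inner_add_right inner_diff_right algebra_simps)
      then show ?thesis using lt[OF z] s by (simp add: ln_mult ln_div)
    qed
    also have "\<dots> \<le> kobayashi_dist \<Omega> q z"
      unfolding kobayashi_dist_def kobayashi_lengths_def[symmetric]
      by (rule cInf_greatest[OF kobayashi_lengths_nonempty[OF \<Omega>(1-3) q z] kobayashi_length_ge_halfspace[OF \<Omega>(1) lt]])
    also have "\<dots> \<le> B + \<alpha> / 2 * ln (1 / boundary_dist \<Omega> q)" by (rule B[OF q])
    also have "\<dots> \<le> B + \<alpha> / 2 * ln (1 / (s * m))"
    proof (intro add_left_mono mult_left_mono)
      have "0 < s * m" using s m(1) by simp
      then have "0 < boundary_dist \<Omega> q" using sm by linarith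
      moreover have "1 / boundary_dist \<Omega> q \<le> 1 / (s * m)"
        by (rule frac_le[OF _ order_refl \<open>0 < s * m\<close> sm]) simp
      ultimately show "ln (1 / boundary_dist \<Omega> q) \<le> ln (1 / (s * m))"
        by (intro ln_mono) simp_all
    qed (use reg(2) in simp)
    also have "ln (1 / (s * m)) = ln (1 / s) + ln (1 / m)" using s m by (simp add: ln_div ln_mult)
    finally show ?thesis .
  qed
  define C where "C = \<bar>B\<bar> + \<alpha> / 2 * \<bar>ln (1 / m)\<bar> + 1"
  define x where "x = 2 * C / (1 - \<alpha>)"
  have C: "C > 0" using reg(2) by (simp add: C_def add_nonneg_pos)
  have x: "x > 0" using C \<open>\<not> 1 \<le> \<alpha>\<close> by (simp add: x_def)
  have "ln (1 / exp (- x)) / 2 \<le> B + \<alpha> / 2 * (ln (1 / exp (- x)) + ln (1 / m))"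
    using x by (intro bound) auto
  then have "x / 2 \<le> B + \<alpha> / 2 * (x + ln (1 / m))" by (simp add: ln_div)
  then have "(1 - \<alpha>) * x / 2 \<le> B + \<alpha> / 2 * ln (1 / m)" by (simp add: algebra_simps diff_divide_distrib)
  also have "\<dots> \<le> \<bar>B\<bar> + \<alpha> / 2 * \<bar>ln (1 / m)\<bar>"
    using reg(2) by (intro add_mono mult_left_mono) auto
  finally have "(1 - \<alpha>) * x / 2 < C" by (simp add: C_def)
  then show False using \<open>\<not> 1 \<le> \<alpha>\<close> by (simp add: x_def)
qed

theorem proposition16p2:
  fixes \<Omega> :: "(complex^'d) set"
  assumes "open \<Omega>" and "\<Omega> \<noteq> {}" and "convex \<Omega>" and "bounded \<Omega>"
    and "C1_boundary \<Omega>"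
  shows "(\<forall>\<epsilon>>0. \<forall>z\<^sub>0\<in>\<Omega>. \<exists>B>0. \<forall>q\<in>\<Omega>.
            kobayashi_dist \<Omega> q z\<^sub>0 \<le> B + (1 + \<epsilon>) / 2 * ln (1 / boundary_dist \<Omega> q))
         \<and> alpha_star \<Omega> = 1"
proof
  show upper: "\<forall>\<epsilon>>0. \<forall>z\<^sub>0\<in>\<Omega>. \<exists>B>0. \<forall>q\<in>\<Omega>.
            kobayashi_dist \<Omega> q z\<^sub>0 \<le> B + (1 + \<epsilon>) / 2 * ln (1 / boundary_dist \<Omega> q)"
    using kobayashi_dist_log_upper_bound assms by blast
  let ?S = "{\<alpha>. \<alpha> > 0 \<and> alpha_regular \<alpha> \<Omega>}"
  have reg: "1 + e \<in> ?S" if "e > 0" for e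
    using upper that unfolding alpha_regular_def by auto
  have ge: "1 \<le> \<alpha>" if "\<alpha> \<in> ?S" for \<alpha> using alpha_regular_ge_one that assms by blast
  have "Inf ?S = 1"
  proof (rule antisym)
    show "Inf ?S \<le> 1"
    proof (rule field_le_epsilon)
      fix e :: real assume "e > 0"
      show "Inf ?S \<le> 1 + e"
        using reg[OF \<open>e > 0\<close>] ge by (intro cInf_lower bdd_belowI) auto
    qed
    show "1 \<le> Inf ?S" using reg[OF zero_less_one] ge by (intro cInf_greatest) blast+
  qed
  then show "alpha_star \<Omega> = 1" by (simp add: alpha_star_def)
qed

end
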